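(* Let $A,B>0$, $k\in\mathbb R\setminus\{0\}$, and let $\chi_0\in\mathbb R\setminus\{0,k,-k\}$ satisfy $\Lambda'(\chi_0)=0$, $\Lambda''(\chi_0)\neq0$. With the notation of the context, let $M_1,c_s\in\mathbb C$ satisfy $$b_J|M_1|^2+2a_J\operatorname{Re}M_1+d_s|c_s|^2=0.$$ Define $\mathbf y_R=\mathbf Y_0+M_1\mathbf Y_1+c_s\mathbf Y_s$ and $$\mathbf y_\mu=\frac1{2\lambda_0}\begin{pmatrix} E_0+M_1E_1 \\ 0 \\ 0 \end{pmatrix}+\frac{s_1M_1-p_1}{2}\mathbf Y_2-\frac{p_1M_1}{6}\mathbf Y_3+c_s\mathbf Y_{s,\mu}.$$ For any fixed $q\in\mathbb C\setminus\mathbb R$ define $$m_q=\frac{2\lambda_0\big[q^*\langle\mathbf y_\mu|J|\mathbf y_R\rangle+q\langle\mathbf y_R|J|\mathbf y_\mu\rangle\big]}{q^*-q}-\frac{\langle\mathbf y_R|K|\mathbf y_R\rangle}{2\lambda_0},$$ and, writing $\mathbf y_R=(\psi_R,\phi_R,\varphi_R)^{\mathsf T}$, $$\begin{pmatrix} u_1^{(R,2;q)} \\ u_2^{(R,2;q)} \end{pmatrix}=\begin{pmatrix} u_{1,0} \\ u_{2,0} \end{pmatrix}+\frac{2\psi_R^*}{m_q}\begin{pmatrix} \phi_R \\ \varphi_R \end{pmatrix}.$$ Then $$\operatorname{Re}m_q=-\frac{\langle\mathbf y_R|K|\mathbf y_R\rangle}{2\lambda_0}<0 .$$ Consequently $m_q$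 has no zeros on the real $(x,t)$-plane, and $(u_1^{(R,2;q)},u_2^{(R,2;q)})$ is a globally smooth exact solution of the coupled Fokas--Lenells system.
   Context: Coupled Fokas--Lenells system for complex functions $u_1,u_2$ of $(x,t)\in\mathbb R^2$: $$u_{1,xt}+u_1+\mathrm i\big(|u_1|^2+\tfrac12|u_2|^2\big)u_{1,x}+\tfrac{\mathrm i}{2}u_1u_2^*u_{2,x}=0,\qquad u_{2,xt}+u_2+\mathrm i\big(|u_2|^2+\tfrac12|u_1|^2\big)u_{2,x}+\tfrac{\mathrm i}{2}u_2u_1^*u_{1,x}=0.$$ $S=A+B$, $R=A-B$; $a_1,a_2\in\mathbb R$ with $a_1^2=A$, $a_2^2=B$; $k_1=k$, $k_2=-k$; $\omega_1=1/k-A$, $\omega_2=-1/k-B$; $u_{j,0}=a_j\exp[\mathrm i(k_jx+\omega_jt)]$. $\Lambda(\chi)=\frac1\chi\big[2-k^2\big(\frac{A}{\chi+k}+\frac{B}{\chi-k}\big)\big]$ for $\chi\notin\{0,\pm k\}$; $D(\chi)=\chi(\chi^2-k^2)$; $F(\chi;\mu)=D(\chi)[\mu-\Lambda(\chi)]=\mu\chi^3-2\chi^2+k^2(S-\mu)\chi+k^2(2-kR)$. $\nu(\chi)=\frac S2+\frac{2-kR}{2\chi}$, $E(\chi)=\exp[\mathrm i(\chi x+\nu(\chi)t)]$, $h_1(\chi)=\frac{k}{k+\chi}$, $h_2(\chi)=\frac{k}{k-\chi}$, $\mathbf y(\chi,\lambda)=(\lambda E(\chi),u_{1,0}h_1(\chi)E(\chi),u_{2,0}h_2(\chi)E(\chi))^{\mathsf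 T}$. $\mu_0=\Lambda(\chi_0)$, automatically positive; $\lambda_0=\sqrt{\mu_0}>0$. $F(\chi;\mu_0)=\mu_0(\chi-\chi_0)^2(\chi-\chi_s)$ with $\chi_s=\frac2{\mu_0}-2\chi_0$; $L_0=\chi_0-\chi_s\ne0$. $\mathbf Y_n=\partial_\chi^n\mathbf y(\chi,\lambda_0)|_{\chi=\chi_0}$ (at fixed $\lambda_0$), $E_n=\partial_\chi^nE(\chi)|_{\chi=\chi_0}$. $D_0=D(\chi_0)$, $D_1=3\chi_0^2-k^2$, $p_1=\frac{D_0}{\mu_0L_0}$, $s_1=\frac{p_1-D_1/\mu_0}{L_0}$. Simple branch: if $\chi_s\neq0$, $\mathbf Y_s=\mathbf y(\chi_s,\lambda_0)$ and $$\mathbf Y_{s,\mu}=\frac1{2\lambda_0}\begin{pmatrix} E(\chi_s) \\ 0 \\ 0 \end{pmatrix}+\kappa_s\,\partial_\chi\mathbf y(\chi,\lambda_0)\big|_{\chi=\chi_s},\qquad \kappa_s=-\frac{D(\chi_s)}{\mu_0L_0^2}.$$ If $\chi_s=0$, then $\mathbf Y_s=e^{\mathrm i\mu_0t/2}(\lambda_0,u_{1,0},u_{2,0})^{\mathsf T}$ and $\mathbf Y_{s,\mu}=e^{\mathrm i\mu_0t/2}\big[\frac1{2\lambda_0}(1,0,0)^{\mathsf T}+\frac{\mathrm it}{2}(\lambda_0,u_{1,0},u_{2,0})^{\mathsf T}\big]$. $J=\operatorname{diag}(1,-1,-1)$, $K=I_3$, $\langle\mathbf f|M|\mathbf g\rangle=\mathbf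 f^\dagger M\mathbf g$; $^*$ is complex conjugation. $a_J=\langle\mathbf Y_0|J|\mathbf Y_1\rangle$, $b_J=\langle\mathbf Y_1|J|\mathbf Y_1\rangle$, $d_s=\langle\mathbf Y_s|J|\mathbf Y_s\rangle$, which are real constants independent of $(x,t)$. *)

theory Defs
  imports "HOL-Analysis.Analysis"
begin

definition pd_x :: "(real \<Rightarrow> real \<Rightarrow> complex) \<Rightarrow> real \<Rightarrow> real \<Rightarrow> complex" where
  "pd_x u x t = vector_derivative (\<lambda>\<xi>. u \<xi> t) (at x)"

definition pd_t :: "(real \<Rightarrow> real \<Rightarrow> complex) \<Rightarrow> real \<Rightarrow> real \<Rightarrow> complex" where
  "pd_t u x t = vector_derivative (\<lambda>\<tau>. u x \<tau>) (at t)"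

(* Class C^n on the real plane: every partial derivative of order below n is (Frechet)
   differentiable and those of order n are continuous. *)
primrec C_class :: "nat \<Rightarrow> (real \<Rightarrow> real \<Rightarrow> complex) \<Rightarrow> bool" where
  "C_class 0 u \<longleftrightarrow> continuous_on UNIV (\<lambda>p. u (fst p) (snd p))"
| "C_class (Suc n) u \<longleftrightarrow>
     (\<lambda>p. u (fst p) (snd p)) differentiable_on UNIV \<and> C_class n (pd_x u) \<and> C_class n (pd_t u)"

definition globally_smooth :: "(real \<Rightarrow> real \<Rightarrow> complex) \<Rightarrow> bool" where
  "globally_smooth u \<longleftrightarrow> (\<forall>n. C_class n u)"

(* pd_t (pd_x u) is u_{xt}. *)
definition solves_coupled_FL ::
    "(real \<Rightarrow> real \<Rightarrow> complex) \<Rightarrow> (real \<Rightarrow> real \<Rightarrow> complex) \<Rightarrow> bool" where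
  "solves_coupled_FL u1 u2 \<longleftrightarrow> (\<forall>x t.
     pd_t (pd_x u1) x t + u1 x t
       + \<i> * of_real ((cmod (u1 x t))\<^sup>2 + (cmod (u2 x t))\<^sup>2 / 2) * pd_x u1 x t
       + \<i> / 2 * u1 x t * cnj (u2 x t) * pd_x u2 x t = 0 \<and>
     pd_t (pd_x u2) x t + u2 x t
       + \<i> * of_real ((cmod (u2 x t))\<^sup>2 + (cmod (u1 x t))\<^sup>2 / 2) * pd_x u2 x t
       + \<i> / 2 * u2 x t * cnj (u1 x t) * pd_x u1 x t = 0)"

definition bra_ket :: "complex^3 \<Rightarrow> complex^3^3 \<Rightarrow> complex^3 \<Rightarrow> complex" where
  "bra_ket f M g = (\<Sum>i\<in>UNIV. cnj (f $ i) * (M *v g) $ i)"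

definition J_mat :: "complex^3^3" where
  "J_mat = vector [vector [1, 0, 0], vector [0, -1, 0], vector [0, 0, -1]]"

definition K_mat :: "complex^3^3" where
  "K_mat = mat 1"

(* n-th derivative of a vector-valued function of the real spectral variable. *)
definition nth_deriv :: "nat \<Rightarrow> (real \<Rightarrow> 'v::real_normed_vector) \<Rightarrow> real \<Rightarrow> 'v" where
  "nth_deriv n f = ((\<lambda>g z. vector_derivative g (at z)) ^^ n) f"

(* The locale carries no assumptions; it only collects the parameters, so each exported
   constant takes those of A B a1 a2 k chi0 M1 cs q on which it depends, in this order. *)
locale FL_double_root =
  fixes A B a1 a2 k chi0 :: real and M1 cs q :: complex
begin

definition S :: real where "S = A + B"
definition R :: real where "R = A - B"

definition omega1 :: real where "omega1 = 1 / k - A"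
definition omega2 :: real where "omega2 = - 1 / k - B"

definition u10 :: "real \<Rightarrow> real \<Rightarrow> complex" where
  "u10 x t = of_real a1 * exp (\<i> * of_real (k * x + omega1 * t))"

definition u20 :: "real \<Rightarrow> real \<Rightarrow> complex" where
  "u20 x t = of_real a2 * exp (\<i> * of_real (- k * x + omega2 * t))"

(* Only used away from the poles 0, k, -k. *)
definition Lam :: "real \<Rightarrow> real" where
  "Lam z = (1 / z) * (2 - k\<^sup>2 * (A / (z + k) + B / (z - k)))"

definition D :: "real \<Rightarrow> real" where
  "D z = z * (z\<^sup>2 - k\<^sup>2)"

definition nu :: "real \<Rightarrow> real" where
  "nu z = S / 2 + (2 - k * R) / (2 * z)"

definition E :: "real \<Rightarrow> real \<Rightarrow> real \<Rightarrow> complex" where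
  "E z x t = exp (\<i> * of_real (z * x + nu z * t))"

definition h1 :: "real \<Rightarrow> real" where "h1 z = k / (k + z)"
definition h2 :: "real \<Rightarrow> real" where "h2 z = k / (k - z)"

definition y :: "real \<Rightarrow> real \<Rightarrow> real \<Rightarrow> real \<Rightarrow> complex^3" where
  "y z l x t = vector [of_real l * E z x t,
                       u10 x t * of_real (h1 z) * E z x t,
                       u20 x t * of_real (h2 z) * E z x t]"

definition mu0 :: real where "mu0 = Lam chi0"
definition lam0 :: real where "lam0 = sqrt mu0"

(* By Vieta, the third root of
   D z * (mu0 - Lam z) = mu0 z^3 - 2 z^2 + k^2 (S - mu0) z + k^2 (2 - k R),
   which has the double root chi0. *)
definition chis :: real where "chis = 2 / mu0 - 2 * chi0"

definition L0 :: real where "L0 = chi0 - chis"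

definition Y :: "nat \<Rightarrow> real \<Rightarrow> real \<Rightarrow> complex^3" where
  "Y n x t = nth_deriv n (\<lambda>z. y z lam0 x t) chi0"

definition En :: "nat \<Rightarrow> real \<Rightarrow> real \<Rightarrow> complex" where
  "En n x t = nth_deriv n (\<lambda>z. E z x t) chi0"

definition D0 :: real where "D0 = D chi0"
definition D1 :: real where "D1 = 3 * chi0\<^sup>2 - k\<^sup>2"
definition p1 :: real where "p1 = D0 / (mu0 * L0)"
definition s1 :: real where "s1 = (p1 - D1 / mu0) / L0"
definition kappas :: real where "kappas = - D chis / (mu0 * L0\<^sup>2)"

definition Ys :: "real \<Rightarrow> real \<Rightarrow> complex^3" where
  "Ys x t =
    (if chis \<noteq> 0 then y chis lam0 x t
     else exp (\<i> * of_real (mu0 * t / 2)) *s vector [of_real lam0, u10 x t, u20 x t])"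

definition Ysmu :: "real \<Rightarrow> real \<Rightarrow> complex^3" where
  "Ysmu x t =
    (if chis \<noteq> 0 then
       of_real (1 / (2 * lam0)) *s vector [E chis x t, 0, 0]
         + of_real kappas *s nth_deriv 1 (\<lambda>z. y z lam0 x t) chis
     else
       exp (\<i> * of_real (mu0 * t / 2)) *s
         (of_real (1 / (2 * lam0)) *s vector [1, 0, 0]
           + (\<i> * of_real t / 2) *s vector [of_real lam0, u10 x t, u20 x t]))"

(* aJ, bJ and ds are real and independent of (x,t) at an admissible chi0, so a relation
   between them at one point (x,t) holds at every point. *)
definition aJ :: "real \<Rightarrow> real \<Rightarrow> complex" where
  "aJ x t = bra_ket (Y 0 x t) J_mat (Y 1 x t)"

definition bJ :: "real \<Rightarrow> real \<Rightarrow> complex" where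
  "bJ x t = bra_ket (Y 1 x t) J_mat (Y 1 x t)"

definition ds :: "real \<Rightarrow> real \<Rightarrow> complex" where
  "ds x t = bra_ket (Ys x t) J_mat (Ys x t)"

definition yR :: "real \<Rightarrow> real \<Rightarrow> complex^3" where
  "yR x t = Y 0 x t + M1 *s Y 1 x t + cs *s Ys x t"

definition ymu :: "real \<Rightarrow> real \<Rightarrow> complex^3" where
  "ymu x t =
     of_real (1 / (2 * lam0)) *s vector [En 0 x t + M1 * En 1 x t, 0, 0]
     + ((of_real s1 * M1 - of_real p1) / 2) *s Y 2 x t
     - (of_real p1 * M1 / 6) *s Y 3 x t
     + cs *s Ysmu x t"

definition mq :: "real \<Rightarrow> real \<Rightarrow> complex" where
  "mq x t =
     2 * of_real lam0 *
       (cnj q * bra_ket (ymu x t) J_mat (yR x t) + q * bra_ket (yR x t) J_mat (ymu x t))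
       / (cnj q - q)
     - bra_ket (yR x t) K_mat (yR x t) / (2 * of_real lam0)"

definition u1R :: "real \<Rightarrow> real \<Rightarrow> complex" where
  "u1R x t = u10 x t + 2 * cnj (yR x t $ 1) / mq x t * yR x t $ 2"

definition u2R :: "real \<Rightarrow> real \<Rightarrow> complex" where
  "u2R x t = u20 x t + 2 * cnj (yR x t $ 1) / mq x t * yR x t $ 3"

end

end

theory Submission
  imports Defs
begin

text \<open>
  The vector \<open>y(\<chi>, \<lambda>)\<close> satisfies the Lax pair of the system up to residuals that are multiples of
  \<open>\<mu> - \<Lambda>(\<chi>)\<close>. At the double root \<open>\<chi>\<^sub>0\<close> both \<open>Y\<^sub>0\<close> and \<open>Y\<^sub>1\<close> are therefore exact solutions, as is
  \<open>Y\<^sub>s\<close>, and the constants \<open>p\<^sub>1\<close>, \<open>s\<^sub>1\<close>, \<open>\<kappa>\<^sub>s\<close> are such that \<open>y\<^sub>\<mu>\<close> solves the Lax pair differentiated in \<open>\<mu>\<close>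
  along \<open>y\<^sub>R\<close>. The hypothesis on \<open>M\<^sub>1\<close> and \<open>c\<^sub>s\<close> says that \<open>y\<^sub>R\<close> is isotropic for \<open>J\<close>. This makes the
  real part of \<open>\<langle>y\<^sub>\<mu>|J|y\<^sub>R\<rangle>\<close> constant, gives the two first-order equations for \<open>m\<^sub>q\<close> that a Darboux
  transformation needs, and leaves \<open>Re m\<^sub>q = - \<langle>y\<^sub>R|K|y\<^sub>R\<rangle> / (2 \<lambda>\<^sub>0)\<close>, which is negative because \<open>Y\<^sub>0\<close>,
  \<open>Y\<^sub>1\<close>, \<open>Y\<^sub>s\<close> are linearly independent at every point. Throughout, the first component of a vector is
  divided by \<open>\<lambda>\<^sub>0\<close>, so that only \<open>\<mu>\<^sub>0\<close> occurs in the equations.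
\<close>

section \<open>Smooth functions on the plane\<close>

text \<open>The constants come from the splitting of the double root. For mu = mu_0 + eta, F has two
  roots chi_0 + delta near chi_0. By Vieta's formulas the two offsets delta have sum s_1 eta and
  product p_1 eta up to O(eta^2). So delta is of order sqrt(eta), and y at a single root is not
  differentiable in mu. The mean of y over the two roots and its divided difference are symmetric in
  the offsets and hence differentiable. At fixed lambda they are Y_0 + eta (s_1 Y_1 - p_1 Y_2) / 2
  and Y_1 + eta (s_1 Y_2 / 2 - p_1 Y_3 / 6) to first order. Subtract s_1 eta / 2 times the divided
  difference from the mean, then add M_1 times the divided difference and c_s times the simple
  branch. The mu-derivative of the result is y_mu; the term with 1 / (2 lambda_0) is the derivative
  of lambda = sqrt(mu). Likewise kappa_s is the derivative of chi_s in mu. This family is never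
  built. Its effect is checked on Lax residuals at mu_0, where only derivatives up to order 3 occur,
  so the spectral calculus below stops there.\<close>

lemma C_class_mono: "C_class (Suc n) u \<Longrightarrow> C_class n u"
proof (induction n arbitrary: u)
  case 0
  then show ?case by (auto intro: differentiable_imp_continuous_on)
next
  case (Suc n)
  then show ?case by (metis C_class.simps(2))
qed


lemma has_vector_derivative_inverse [derivative_intros]:
  fixes f :: "real \<Rightarrow> complex"
  assumes "(f has_vector_derivative f') (at x)" "f x \<noteq> 0"
  shows "((\<lambda>x. inverse (f x)) has_vector_derivative - (f' * (inverse (f x))\<^sup>2)) (at x)"
  using field_vector_diff_chain_at[OF assms(1) DERIV_inverse[OF assms(2)]]
  by (simp add: o_def power2_eq_square)

lemma has_vector_derivative_exp [derivative_intros]: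
  fixes f :: "real \<Rightarrow> complex"
  assumes "(f has_vector_derivative f') (at x)"
  shows "((\<lambda>x. exp (f x)) has_vector_derivative f' * exp (f x)) (at x)"
  using field_vector_diff_chain_at[OF assms DERIV_exp] by (simp add: o_def)

lemma pd_works:
  assumes "(\<lambda>p. u (fst p) (snd p)) differentiable_on UNIV"
  shows "((\<lambda>\<xi>. u \<xi> t) has_vector_derivative pd_x u x t) (at x)"
    and "((\<lambda>\<tau>. u x \<tau>) has_vector_derivative pd_t u x t) (at t)"
proof -
  have d: "(\<lambda>p. u (fst p) (snd p)) differentiable (at (x, t))"
    using assms by (simp add: differentiable_on_def)
  have "(\<lambda>\<xi>. u (fst (\<xi>, t)) (snd (\<xi>, t))) differentiable (at x)"
    by (rule differentiable_compose[where f = "\<lambda>p. u (fst p) (snd p)" and g = "\<lambda>\<xi>. (\<xi>, t)", OF d])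
      (auto simp: differentiable_def intro!: exI derivative_intros)
  then show "((\<lambda>\<xi>. u \<xi> t) has_vector_derivative pd_x u x t) (at x)"
    by (simp add: pd_x_def flip: vector_derivative_works)
  have "(\<lambda>\<tau>. u (fst (x, \<tau>)) (snd (x, \<tau>))) differentiable (at t)"
    by (rule differentiable_compose[where f = "\<lambda>p. u (fst p) (snd p)" and g = "\<lambda>\<tau>. (x, \<tau>)", OF d])
      (auto simp: differentiable_def intro!: exI derivative_intros)
  then show "((\<lambda>\<tau>. u x \<tau>) has_vector_derivative pd_t u x t) (at t)"
    by (simp add: pd_t_def flip: vector_derivative_works)
qed

lemma pd_x_eqI:
  "(\<And>x t. ((\<lambda>\<xi>. u \<xi> t) has_vector_derivative v x t) (at x)) \<Longrightarrow> pd_x u = v"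
  by (auto simp: pd_x_def fun_eq_iff intro: vector_derivative_at)

lemma pd_t_eqI:
  "(\<And>x t. ((\<lambda>\<tau>. u x \<tau>) has_vector_derivative v x t) (at t)) \<Longrightarrow> pd_t u = v"
  by (auto simp: pd_t_def fun_eq_iff intro: vector_derivative_at)

lemma C_class_const: "C_class n (\<lambda>x t. a)"
proof (induction n arbitrary: a)
  case (Suc n)
  have "pd_x (\<lambda>x t. a) = (\<lambda>x t. 0)" "pd_t (\<lambda>x t. a) = (\<lambda>x t. 0)"
    by (rule pd_x_eqI pd_t_eqI, simp)+
  with Suc show ?case by simp
qed simp

lemma C_class_add:
  "C_class n u \<Longrightarrow> C_class n v \<Longrightarrow> C_class n (\<lambda>x t. u x t + v x t)"
proof (induction n arbitrary: u v)
  case 0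
  then show ?case by (auto intro: continuous_on_add)
next
  case (Suc n)
  have "pd_x (\<lambda>x t. u x t + v x t) = (\<lambda>x t. pd_x u x t + pd_x v x t)"
    "pd_t (\<lambda>x t. u x t + v x t) = (\<lambda>x t. pd_t u x t + pd_t v x t)"
    using Suc.prems by (auto intro!: pd_x_eqI pd_t_eqI derivative_intros pd_works)
  with Suc show ?case by simp
qed

lemma C_class_mult:
  "C_class n u \<Longrightarrow> C_class n v \<Longrightarrow> C_class n (\<lambda>x t. u x t * v x t)"
proof (induction n arbitrary: u v)
  case 0
  then show ?case by (auto intro: continuous_on_mult)
next
  case (Suc n)
  have "pd_x (\<lambda>x t. u x t * v x t) = (\<lambda>x t. u x t * pd_x v x t + pd_x u x t * v x t)"
    "pd_t (\<lambda>x t. u x t * v x t) = (\<lambda>x t. u x t * pd_t v x t + pd_t u x t * v x t)"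
    using Suc.prems by (auto intro!: pd_x_eqI pd_t_eqI derivative_intros pd_works)
  moreover have "C_class n u" "C_class n v"
    using Suc.prems C_class_mono by blast+
  ultimately show ?case using Suc by (auto intro!: C_class_add)
qed

lemma C_class_cnj: "C_class n u \<Longrightarrow> C_class n (\<lambda>x t. cnj (u x t))"
proof (induction n arbitrary: u)
  case 0
  then show ?case by (auto intro: continuous_on_cnj)
next
  case (Suc n)
  have "pd_x (\<lambda>x t. cnj (u x t)) = (\<lambda>x t. cnj (pd_x u x t))"
    "pd_t (\<lambda>x t. cnj (u x t)) = (\<lambda>x t. cnj (pd_t u x t))"
    using Suc.prems by (auto intro!: pd_x_eqI pd_t_eqI derivative_intros pd_works)
  moreover have "(\<lambda>p. cnj (u (fst p) (snd p))) differentiable_on UNIV"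
    unfolding differentiable_on_def
  proof
    fix p
    have "(\<lambda>p. u (fst p) (snd p)) differentiable (at p)"
      using Suc.prems by (cases p) (simp add: differentiable_on_def)
    then show "(\<lambda>p. cnj (u (fst p) (snd p))) differentiable (at p)"
      by (rule differentiable_compose[rotated])
        (rule bounded_linear_imp_differentiable[OF bounded_linear_cnj])
  qed
  ultimately show ?case using Suc by simp
qed

lemma C_class_inverse:
  assumes "\<And>x t. u x t \<noteq> 0"
  shows "C_class n u \<Longrightarrow> C_class n (\<lambda>x t. inverse (u x t))"
proof (induction n)
  case 0
  then show ?case using assms by (auto intro: continuous_on_inverse)
next
  case (Suc n)
  \<comment> \<open>The derivative is written with \<open>inverse (u x t)\<close> as a repeated
    factor, so that \<open>C_class_mult\<close> and the induction hypothesis apply to it.\<close>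
  have "pd_x (\<lambda>x t. inverse (u x t)) = (\<lambda>x t. (-1) * (pd_x u x t * (inverse (u x t) * inverse (u x t))))"
    "pd_t (\<lambda>x t. inverse (u x t)) = (\<lambda>x t. (-1) * (pd_t u x t * (inverse (u x t) * inverse (u x t))))"
    using Suc.prems assms
    by (auto intro!: pd_x_eqI pd_t_eqI derivative_eq_intros pd_works simp: power2_eq_square)
  moreover have "C_class n u"
    using Suc.prems C_class_mono by blast
  moreover have "(\<lambda>p. inverse (u (fst p) (snd p))) differentiable_on UNIV"
    using Suc.prems assms by (auto simp: differentiable_on_def intro: differentiable_inverse)
  moreover have "C_class n (\<lambda>x t. (-1) * (v x t * (inverse (u x t) * inverse (u x t))))"
    if "C_class n v" for v
    using that \<open>C_class n u\<close> Suc.IH by (intro C_class_mult C_class_const)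
  ultimately show ?case using Suc.prems by simp
qed

lemma differentiable_of_real_affine:
  "(\<lambda>p. complex_of_real (a * fst p + b * snd p)) differentiable (at p)"
  unfolding differentiable_def
  by (rule exI, rule has_derivative_of_real, (rule derivative_intros)+)

lemma C_class_of_real_affine: "C_class n (\<lambda>x t. of_real (a * x + b * t))"
proof (cases n)
  case 0
  then show ?thesis by (auto intro!: continuous_intros)
next
  case (Suc m)
  have "pd_x (\<lambda>x t. of_real (a * x + b * t)) = (\<lambda>x t. of_real a)"
    "pd_t (\<lambda>x t. of_real (a * x + b * t)) = (\<lambda>x t. of_real b)"
    by (rule pd_x_eqI pd_t_eqI, auto intro!: derivative_eq_intros)+
  moreover have "(\<lambda>p. complex_of_real (a * fst p + b * snd p)) differentiable_on UNIV"
    by (simp add: differentiable_on_def differentiable_of_real_affine del: of_real_add of_real_mult)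
  ultimately show ?thesis using Suc by (simp add: C_class_const)
qed

lemma C_class_exp: "C_class n (\<lambda>x t. exp (\<i> * of_real (a * x + b * t)))"
proof (induction n)
  case 0
  then show ?case by (auto intro!: continuous_intros)
next
  case (Suc n)
  let ?e = "\<lambda>x t. exp (\<i> * of_real (a * x + b * t))"
  have "pd_x ?e = (\<lambda>x t. (\<i> * of_real a) * ?e x t)" "pd_t ?e = (\<lambda>x t. (\<i> * of_real b) * ?e x t)"
    by (rule pd_x_eqI pd_t_eqI, auto intro!: derivative_eq_intros)+
  moreover have "(\<lambda>p. ?e (fst p) (snd p)) differentiable_on UNIV"
    unfolding differentiable_on_def
    by (intro ballI, rule differentiable_compose[of exp])
      (intro field_differentiable_imp_differentiable field_differentiable_within_exp
        differentiable_mult differentiable_const differentiable_of_real_affine)+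
  moreover have "C_class n (\<lambda>x t. (\<i> * of_real e) * ?e x t)" for e
    by (intro C_class_mult C_class_const Suc.IH)
  ultimately show ?case by (simp del: of_real_add of_real_mult)
qed

lemma globally_smooth_const: "globally_smooth (\<lambda>x t. a)"
  by (simp add: globally_smooth_def C_class_const)

lemma globally_smooth_of_real_affine: "globally_smooth (\<lambda>x t. of_real (a * x + b * t))"
  unfolding globally_smooth_def using C_class_of_real_affine by blast

lemma globally_smooth_exp: "globally_smooth (\<lambda>x t. exp (\<i> * of_real (a * x + b * t)))"
  unfolding globally_smooth_def using C_class_exp by blast

lemma globally_smooth_add:
  "globally_smooth u \<Longrightarrow> globally_smooth v \<Longrightarrow> globally_smooth (\<lambda>x t. u x t + v x t)"
  by (simp add: globally_smooth_def C_class_add)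

lemma globally_smooth_mult:
  "globally_smooth u \<Longrightarrow> globally_smooth v \<Longrightarrow> globally_smooth (\<lambda>x t. u x t * v x t)"
  by (simp add: globally_smooth_def C_class_mult)

lemma globally_smooth_cnj: "globally_smooth u \<Longrightarrow> globally_smooth (\<lambda>x t. cnj (u x t))"
  by (simp add: globally_smooth_def C_class_cnj)

lemma globally_smooth_inverse:
  "globally_smooth u \<Longrightarrow> (\<And>x t. u x t \<noteq> 0) \<Longrightarrow> globally_smooth (\<lambda>x t. inverse (u x t))"
  by (simp add: globally_smooth_def C_class_inverse)

lemma globally_smooth_minus:
  "globally_smooth u \<Longrightarrow> globally_smooth (\<lambda>x t. - u x t)"
  using globally_smooth_mult[OF globally_smooth_const[of "-1"]] by simp

lemma globally_smooth_diff:
  "globally_smooth u \<Longrightarrow> globally_smooth v \<Longrightarrow> globally_smooth (\<lambda>x t. u x t - v x t)"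
  using globally_smooth_add[OF _ globally_smooth_minus] by fastforce

lemma globally_smooth_divide:
  "globally_smooth u \<Longrightarrow> globally_smooth v \<Longrightarrow> (\<And>x t. v x t \<noteq> 0) \<Longrightarrow>
    globally_smooth (\<lambda>x t. u x t / v x t)"
  by (simp add: divide_inverse globally_smooth_mult globally_smooth_inverse)

lemmas globally_smooth_intros =
  globally_smooth_const globally_smooth_of_real_affine globally_smooth_exp globally_smooth_add
  globally_smooth_mult globally_smooth_cnj globally_smooth_minus globally_smooth_diff
  globally_smooth_divide

section \<open>The Darboux transformation\<close>

type_synonym plane_fun = "real \<Rightarrow> real \<Rightarrow> complex"

text \<open>\<open>pd_x\<close> has a value even where no derivative exists; the relation also
  carries existence, so it can be fed to the product and quotient rules.\<close>

definition has_pd_x :: "plane_fun \<Rightarrow> plane_fun \<Rightarrow> bool" where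
  "has_pd_x u v \<longleftrightarrow> (\<forall>x t. ((\<lambda>\<xi>. u \<xi> t) has_vector_derivative v x t) (at x))"

definition has_pd_t :: "plane_fun \<Rightarrow> plane_fun \<Rightarrow> bool" where
  "has_pd_t u v \<longleftrightarrow> (\<forall>x t. ((\<lambda>\<tau>. u x \<tau>) has_vector_derivative v x t) (at t))"

lemma has_pd_xD: "has_pd_x u v \<Longrightarrow> ((\<lambda>\<xi>. u \<xi> t) has_vector_derivative v x t) (at x)"
  by (simp add: has_pd_x_def)

lemma has_pd_tD: "has_pd_t u v \<Longrightarrow> ((\<lambda>\<tau>. u x \<tau>) has_vector_derivative v x t) (at t)"
  by (simp add: has_pd_t_def)

lemma has_pd_x_eq: "has_pd_x u v \<Longrightarrow> pd_x u = v"
  by (rule pd_x_eqI) (simp add: has_pd_x_def)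

lemma has_pd_t_eq: "has_pd_t u v \<Longrightarrow> pd_t u = v"
  by (rule pd_t_eqI) (simp add: has_pd_t_def)

text \<open>The Lax pair at the spectral parameter \<open>\<lambda>\<close> with \<open>\<mu> = \<lambda>\<^sup>2\<close>, for the vector \<open>(\<lambda> c, p, r)\<close>.
  The scalars \<open>f\<close> and \<open>g\<close> are inhomogeneities: every residual that occurs below has the shape
  \<open>(\<lambda> f, 0, 0)\<close> in the \<open>x\<close>-part and \<open>g (\<lambda>, u\<^sub>1, u\<^sub>2)\<close> in the \<open>t\<close>-part.\<close>

definition lax ::
  "complex \<Rightarrow> plane_fun \<Rightarrow> plane_fun \<Rightarrow> plane_fun \<Rightarrow> plane_fun \<Rightarrow> plane_fun \<Rightarrow> plane_fun \<Rightarrow> plane_fun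
    \<Rightarrow> plane_fun \<Rightarrow> plane_fun \<Rightarrow> bool" where
  "lax mu u1 v1 u2 v2 c p r f g \<longleftrightarrow>
     has_pd_x c (\<lambda>x t. 2 * \<i> / mu * c x t + (cnj (v1 x t) * p x t + cnj (v2 x t) * r x t) / mu + f x t) \<and>
     has_pd_x p (\<lambda>x t. v1 x t * c x t) \<and>
     has_pd_x r (\<lambda>x t. v2 x t * c x t) \<and>
     has_pd_t c (\<lambda>x t. \<i> * mu / 2 * c x t - \<i> / 2 * (cnj (u1 x t) * p x t + cnj (u2 x t) * r x t)
       + \<i> / 2 * (cnj (u1 x t) * u1 x t + cnj (u2 x t) * u2 x t) * c x t + g x t) \<and>
     has_pd_t p (\<lambda>x t. \<i> * mu / 2 * u1 x t * c x t
       - \<i> / 2 * u1 x t * (cnj (u1 x t) * p x t + cnj (u2 x t) * r x t) + u1 x t * g x t) \<and>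
     has_pd_t r (\<lambda>x t. \<i> * mu / 2 * u2 x t * c x t
       - \<i> / 2 * u2 x t * (cnj (u1 x t) * p x t + cnj (u2 x t) * r x t) + u2 x t * g x t)"

lemma has_pd_x_add:
  "has_pd_x u v \<Longrightarrow> has_pd_x u' v' \<Longrightarrow> (\<And>x t. v x t + v' x t = w x t) \<Longrightarrow>
    has_pd_x (\<lambda>x t. u x t + u' x t) w"
  unfolding has_pd_x_def by (metis has_vector_derivative_add)

lemma has_pd_t_add:
  "has_pd_t u v \<Longrightarrow> has_pd_t u' v' \<Longrightarrow> (\<And>x t. v x t + v' x t = w x t) \<Longrightarrow>
    has_pd_t (\<lambda>x t. u x t + u' x t) w"
  unfolding has_pd_t_def by (metis has_vector_derivative_add)

lemma has_pd_x_cmult: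
  "has_pd_x u v \<Longrightarrow> (\<And>x t. a * v x t = w x t) \<Longrightarrow> has_pd_x (\<lambda>x t. a * u x t) w"
  unfolding has_pd_x_def by (metis has_vector_derivative_mult_right)

lemma has_pd_t_cmult:
  "has_pd_t u v \<Longrightarrow> (\<And>x t. a * v x t = w x t) \<Longrightarrow> has_pd_t (\<lambda>x t. a * u x t) w"
  unfolding has_pd_t_def by (metis has_vector_derivative_mult_right)

lemma lax_add:
  assumes "lax mu u1 v1 u2 v2 c p r f g" "lax mu u1 v1 u2 v2 c' p' r' f' g'"
  shows "lax mu u1 v1 u2 v2 (\<lambda>x t. c x t + c' x t) (\<lambda>x t. p x t + p' x t) (\<lambda>x t. r x t + r' x t)
    (\<lambda>x t. f x t + f' x t) (\<lambda>x t. g x t + g' x t)"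
  using assms unfolding lax_def
  by (elim conjE, intro conjI)
    ((erule (1) has_pd_x_add has_pd_t_add, simp add: algebra_simps add_divide_distrib)+)

lemma lax_cmult:
  assumes "lax mu u1 v1 u2 v2 c p r f g"
  shows "lax mu u1 v1 u2 v2 (\<lambda>x t. a * c x t) (\<lambda>x t. a * p x t) (\<lambda>x t. a * r x t)
    (\<lambda>x t. a * f x t) (\<lambda>x t. a * g x t)"
  using assms unfolding lax_def
  by (elim conjE, intro conjI)
    ((erule has_pd_x_cmult has_pd_t_cmult, simp add: algebra_simps add_divide_distrib)+)

lemma lax_swap:
  "lax mu u1 v1 u2 v2 c p r f g \<Longrightarrow> lax mu u2 v2 u1 v1 c r p f g"
  unfolding lax_def by (simp add: add.commute)

text \<open>\<open>v1\<close> and \<open>v2\<close> name the x-derivatives. The nonlinearity is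
  grouped as (|u|^2 u_x + u (u, u_x)) / 2 for the vector u = (u_1, u_2), with (u, u_x) the Hermitian
  product; this is the system itself, and it shows the symmetry between the two components.\<close>

locale FL_seed =
  fixes u1 v1 u2 v2 :: plane_fun and mu :: complex
  assumes mu_nz: "mu \<noteq> 0" and cnj_mu [simp]: "cnj mu = mu"
    and u1_x: "has_pd_x u1 v1" and u2_x: "has_pd_x u2 v2"
    and v1_t: "has_pd_t v1 (\<lambda>x t. - u1 x t
      - \<i> / 2 * ((cnj (u1 x t) * u1 x t + cnj (u2 x t) * u2 x t) * v1 x t
               + u1 x t * (cnj (u1 x t) * v1 x t + cnj (u2 x t) * v2 x t)))"
    and v2_t: "has_pd_t v2 (\<lambda>x t. - u2 x t
      - \<i> / 2 * ((cnj (u1 x t) * u1 x t + cnj (u2 x t) * u2 x t) * v2 x t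
               + u2 x t * (cnj (u1 x t) * v1 x t + cnj (u2 x t) * v2 x t)))"

text \<open>Here \<open>b\<close> stands for 1 / M, \<open>d\<close> and \<open>rs\<close> for the
  conjugates of \<open>c\<close> and \<open>rho\<close>, \<open>w\<close> for |u|^2,
  \<open>sg\<close> for (u, u_x) and \<open>rho\<close> for (u, (p, r)). With conjugates as
  independent letters the dressed equation becomes a rational identity. It holds because
  \<open>Kt + \<i> / 2 * KUU\<close> and \<open>1 + \<i> / 2 * UX\<close> are both multiples of
  \<open>K\<close>; what remains after extracting \<open>K\<close> cancels term by term.\<close>

lemma darboux_identity:
  fixes c d p b g sg w rho rs u ux mu n K P Pt Kt KUU UX uxt h :: complex
  assumes mu: "mu \<noteq> 0"
    and K: "K = 1 + 2 * c * d * b"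
    and Kt: "Kt = - \<i> * b * (rho * d - rs * c) - 2 * \<i> * b\<^sup>2 * c * d * (d * rho - mu * c * d)"
    and P: "P = ux + 2 / mu * b * p * h"
    and Pt: "Pt = - u - \<i> / 2 * (w * ux + u * sg)
       + 2 / mu * (- \<i> * b\<^sup>2 * (d * rho - mu * c * d) * p * h
                   + b * (\<i> * mu / 2 * u * c - \<i> / 2 * u * rho) * h
                   + b * p * (- \<i> * mu / 2 * d * (sg - 2 * \<i>) - \<i> / 2 * w * h))"
    and KUU: "KUU = K * (w + 2 * b * d * rho) - 2 * b * c * rs - 4 * mu * b\<^sup>2 * c\<^sup>2 * d\<^sup>2"
    and UX: "UX = K * (sg + 2 / mu * b * rho * h - 2 * b * c * h) - 4 * \<i> * b * c * d"
  shows "Kt * P + K * Pt + (u + 2 * b * d * p) + \<i> / 2 * (KUU * P + (u + 2 * b * d * p) * UX) = 0"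
proof -
  have 1: "Kt + \<i> / 2 * KUU = \<i> / 2 * K * w"
    unfolding Kt KUU K by (simp add: algebra_simps power2_eq_square)
  have 2: "1 + \<i> / 2 * UX = K * (1 + \<i> / 2 * (sg + 2 / mu * b * rho * h - 2 * b * c * h))"
    unfolding UX K by (simp add: algebra_simps add_divide_distrib power2_eq_square)
  have 3: "\<i> / 2 * w * P + Pt
      + (u + 2 * b * d * p) * (1 + \<i> / 2 * (sg + 2 / mu * b * rho * h - 2 * b * c * h)) = 0"
    unfolding P Pt using mu by (simp add: field_simps power2_eq_square)
  have "Kt * P + K * Pt + (u + 2 * b * d * p) + \<i> / 2 * (KUU * P + (u + 2 * b * d * p) * UX)
      = (Kt + \<i> / 2 * KUU) * P + K * Pt + (u + 2 * b * d * p) * (1 + \<i> / 2 * UX)"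
    by (simp add: algebra_simps)
  also have "\<dots> = K * (\<i> / 2 * w * P + Pt
      + (u + 2 * b * d * p) * (1 + \<i> / 2 * (sg + 2 / mu * b * rho * h - 2 * b * c * h)))"
    unfolding 1 2 by (simp add: algebra_simps add_divide_distrib)
  finally show ?thesis using 3 by simp
qed

section \<open>Dressing a seed solution by an isotropic Lax solution and a potential M\<close>

locale FL_darboux = FL_seed +
  fixes c p r M :: plane_fun
  assumes lax0: "lax mu u1 v1 u2 v2 c p r (\<lambda>x t. 0) (\<lambda>x t. 0)"
    and null: "\<And>x t. mu * (c x t * cnj (c x t)) = p x t * cnj (p x t) + r x t * cnj (r x t)"
    and M_x: "has_pd_x M (\<lambda>x t. 4 * \<i> / mu * c x t * cnj (c x t)
      - 2 / mu * c x t * (cnj (p x t) * v1 x t + cnj (r x t) * v2 x t))"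
    and M_t: "has_pd_t M (\<lambda>x t. \<i> * cnj (c x t) * (cnj (u1 x t) * p x t + cnj (u2 x t) * r x t)
      - \<i> * mu * c x t * cnj (c x t))"
    and M_cnj: "\<And>x t. M x t + cnj (M x t) = - 2 * c x t * cnj (c x t)"
    and M_nz: "\<And>x t. M x t \<noteq> 0"
begin

text \<open>By the x-part of the Lax pair this is \<open>mu\<close> times the x-derivative of
  \<open>cnj c\<close>. In these terms the assumption \<open>M_x\<close> reads M_x = - 2 c H /
  mu.\<close>

definition H :: plane_fun where
  "H x t = cnj (p x t) * v1 x t + cnj (r x t) * v2 x t - 2 * \<i> * cnj (c x t)"

text \<open>By \<open>M_cnj\<close> this is - cnj M / M, a factor of modulus one.\<close>

definition K :: plane_fun where
  "K x t = 1 + 2 * c x t * cnj (c x t) * inverse (M x t)"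

definition P :: plane_fun where
  "P x t = v1 x t + 2 / mu * inverse (M x t) * p x t * H x t"

definition U1 :: plane_fun where "U1 x t = u1 x t + 2 * inverse (M x t) * cnj (c x t) * p x t"
definition U2 :: plane_fun where "U2 x t = u2 x t + 2 * inverse (M x t) * cnj (c x t) * r x t"

lemmas lax0' = lax0[unfolded lax_def]
lemmas c_x = lax0'[THEN conjunct1, THEN has_pd_xD]
lemmas p_x = lax0'[THEN conjunct2, THEN conjunct1, THEN has_pd_xD]
lemmas c_t = lax0'[THEN conjunct2, THEN conjunct2, THEN conjunct2, THEN conjunct1, THEN has_pd_tD]
lemmas p_t = lax0'[THEN conjunct2, THEN conjunct2, THEN conjunct2, THEN conjunct2, THEN conjunct1,
    THEN has_pd_tD]
lemmas r_t = lax0'[THEN conjunct2, THEN conjunct2, THEN conjunct2, THEN conjunct2, THEN conjunct2,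
    THEN has_pd_tD]

text \<open>Since M_x = - 2 c H / mu, differentiating 1 / M reproduces the term with
  \<open>H\<close> multiplied by 2 c cnj c / M, and \<open>p_x\<close> does the same to
  \<open>v1\<close>. Hence \<open>K\<close> factors out.\<close>

lemma U1_x: "has_pd_x U1 (\<lambda>x t. K x t * P x t)"
  unfolding has_pd_x_def U1_def K_def P_def H_def
  apply (intro allI)
  apply (rule has_vector_derivative_eq_rhs)
   apply (rule derivative_intros u1_x[THEN has_pd_xD] c_x p_x M_x[THEN has_pd_xD] M_nz)+
  using mu_nz
  apply (simp add: field_simps power2_eq_square M_nz)
  done

lemma H_t: "has_pd_t H (\<lambda>x t. - \<i> * mu / 2 * cnj (c x t)
    * (cnj (u1 x t) * v1 x t + cnj (u2 x t) * v2 x t - 2 * \<i>)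
    - \<i> / 2 * (cnj (u1 x t) * u1 x t + cnj (u2 x t) * u2 x t) * H x t)"
  unfolding has_pd_t_def H_def
  apply (intro allI)
  apply (rule has_vector_derivative_eq_rhs)
   apply (rule derivative_intros v1_t[THEN has_pd_tD] v2_t[THEN has_pd_tD] c_t p_t r_t)+
  apply (simp add: field_simps power2_eq_square)
  done

text \<open>This removes the conjugate of 1 / M from every product that carries a factor
  \<open>K\<close>, so that the quadratic expressions in the dressed field become rational in M
  alone.\<close>

lemma cnj_inverse_M: "K x t * cnj (inverse (M x t)) = - inverse (M x t)"
proof -
  have "M x t + 2 * c x t * cnj (c x t) = - cnj (M x t)"
    using M_cnj[of x t] by (simp add: eq_neg_iff_add_eq_0 algebra_simps)
  then have "K x t = - cnj (M x t) / M x t"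
    using M_nz[of x t] by (simp add: K_def divide_simps)
  then show ?thesis using M_nz[of x t] by (simp add: field_simps)
qed

lemma K_t: "has_pd_t K (\<lambda>x t.
    - \<i> * inverse (M x t) * ((cnj (u1 x t) * p x t + cnj (u2 x t) * r x t) * cnj (c x t)
       - cnj (cnj (u1 x t) * p x t + cnj (u2 x t) * r x t) * c x t)
    - 2 * \<i> * (inverse (M x t))\<^sup>2 * c x t * cnj (c x t)
       * (cnj (c x t) * (cnj (u1 x t) * p x t + cnj (u2 x t) * r x t) - mu * c x t * cnj (c x t)))"
  unfolding has_pd_t_def K_def
  apply (intro allI)
  apply (rule has_vector_derivative_eq_rhs)
   apply (rule derivative_intros c_t p_t r_t M_t[THEN has_pd_tD] M_nz)+
  apply (simp add: field_simps power2_eq_square M_nz)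
  done

lemma P_t: "has_pd_t P (\<lambda>x t.
    - u1 x t - \<i> / 2 * ((cnj (u1 x t) * u1 x t + cnj (u2 x t) * u2 x t) * v1 x t
       + u1 x t * (cnj (u1 x t) * v1 x t + cnj (u2 x t) * v2 x t))
    + 2 / mu * (- \<i> * (inverse (M x t))\<^sup>2
        * (cnj (c x t) * (cnj (u1 x t) * p x t + cnj (u2 x t) * r x t) - mu * c x t * cnj (c x t))
        * p x t * H x t
      + inverse (M x t) * (\<i> * mu / 2 * u1 x t * c x t
          - \<i> / 2 * u1 x t * (cnj (u1 x t) * p x t + cnj (u2 x t) * r x t)) * H x t
      + inverse (M x t) * p x t * (- \<i> * mu / 2 * cnj (c x t)
            * (cnj (u1 x t) * v1 x t + cnj (u2 x t) * v2 x t - 2 * \<i>)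
          - \<i> / 2 * (cnj (u1 x t) * u1 x t + cnj (u2 x t) * u2 x t) * H x t)))"
  unfolding has_pd_t_def P_def
  apply (intro allI)
  apply (rule has_vector_derivative_eq_rhs)
   apply (rule derivative_intros c_t p_t r_t M_t[THEN has_pd_tD] v1_t[THEN has_pd_tD]
      H_t[THEN has_pd_tD] M_nz)+
  apply (simp add: algebra_simps power2_eq_square)
  done

definition P2 :: plane_fun where
  "P2 x t = v2 x t + 2 / mu * inverse (M x t) * r x t * H x t"

text \<open>The conjugated field contributes \<open>cnj (inverse (M x t))\<close>, which the
  prefactor \<open>K\<close> absorbs by \<open>cnj_inverse_M\<close>; the remaining |p|^2 + |r|^2 is
  replaced by mu |c|^2 through \<open>null\<close>. The same two moves prove
  \<open>inner_U_Ux\<close>.\<close>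

lemma K_norm: "K x t * (cnj (U1 x t) * U1 x t + cnj (U2 x t) * U2 x t)
  = K x t * (cnj (u1 x t) * u1 x t + cnj (u2 x t) * u2 x t
      + 2 * inverse (M x t) * cnj (c x t) * (cnj (u1 x t) * p x t + cnj (u2 x t) * r x t))
    - 2 * inverse (M x t) * c x t * cnj (cnj (u1 x t) * p x t + cnj (u2 x t) * r x t)
    - 4 * mu * (inverse (M x t))\<^sup>2 * (c x t)\<^sup>2 * (cnj (c x t))\<^sup>2"
proof -
  let ?b = "inverse (M x t)" and ?c = "c x t" and ?d = "cnj (c x t)" and ?p = "p x t" and ?r = "r x t"
  have "K x t * (cnj (U1 x t) * U1 x t + cnj (U2 x t) * U2 x t)
    = K x t * (cnj (u1 x t) * u1 x t + cnj (u2 x t) * u2 x t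
      + 2 * ?b * ?d * (cnj (u1 x t) * ?p + cnj (u2 x t) * ?r))
    + (K x t * cnj ?b) * (2 * ?c * cnj (cnj (u1 x t) * ?p + cnj (u2 x t) * ?r)
      + 4 * ?b * ?c * ?d * (?p * cnj ?p + ?r * cnj ?r))"
    unfolding U1_def U2_def by (simp add: algebra_simps)
  then show ?thesis
    unfolding cnj_inverse_M null[symmetric] by (simp add: algebra_simps power2_eq_square)
qed

lemma inner_U_Ux: "cnj (U1 x t) * (K x t * P x t) + cnj (U2 x t) * (K x t * P2 x t)
  = K x t * (cnj (u1 x t) * v1 x t + cnj (u2 x t) * v2 x t
      + 2 / mu * inverse (M x t) * (cnj (u1 x t) * p x t + cnj (u2 x t) * r x t) * H x t
      - 2 * inverse (M x t) * c x t * H x t)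
    - 4 * \<i> * inverse (M x t) * c x t * cnj (c x t)"
proof -
  let ?b = "inverse (M x t)" and ?c = "c x t" and ?d = "cnj (c x t)" and ?p = "p x t" and ?r = "r x t"
  have "cnj (U1 x t) * (K x t * P x t) + cnj (U2 x t) * (K x t * P2 x t)
    = K x t * (cnj (u1 x t) * v1 x t + cnj (u2 x t) * v2 x t
      + 2 / mu * ?b * (cnj (u1 x t) * ?p + cnj (u2 x t) * ?r) * H x t)
    + (K x t * cnj ?b) * (2 * ?c * (cnj ?p * v1 x t + cnj ?r * v2 x t
      + 2 / mu * ?b * H x t * (?p * cnj ?p + ?r * cnj ?r)))"
    unfolding U1_def U2_def P_def P2_def by (simp add: algebra_simps add_divide_distrib)
  also have "\<dots> = K x t * (cnj (u1 x t) * v1 x t + cnj (u2 x t) * v2 x t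
      + 2 / mu * ?b * (cnj (u1 x t) * ?p + cnj (u2 x t) * ?r) * H x t)
    - 2 * ?b * ?c * (H x t + 2 * \<i> * ?d + 2 * ?b * H x t * (?c * ?d))"
  proof -
    have "2 / mu * ?b * H x t * (mu * (?c * ?d)) = 2 * ?b * H x t * (?c * ?d)"
      using mu_nz by simp
    then show ?thesis
      unfolding cnj_inverse_M null[symmetric] by (simp only: H_def) (simp add: algebra_simps)
  qed
  also have "\<dots> = K x t * (cnj (u1 x t) * v1 x t + cnj (u2 x t) * v2 x t
      + 2 / mu * ?b * (cnj (u1 x t) * ?p + cnj (u2 x t) * ?r) * H x t - 2 * ?b * ?c * H x t)
    - 4 * \<i> * ?b * ?c * ?d"
    by (simp add: K_def algebra_simps)
  finally show ?thesis .
qed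

lemma first_equation:
  "pd_t (pd_x U1) x t + U1 x t
    + \<i> / 2 * ((cnj (U1 x t) * U1 x t + cnj (U2 x t) * U2 x t) * pd_x U1 x t
      + U1 x t * (cnj (U1 x t) * pd_x U1 x t + cnj (U2 x t) * (K x t * P2 x t))) = 0"
proof -
  have x: "pd_x U1 = (\<lambda>x t. K x t * P x t)"
    by (rule has_pd_x_eq[OF U1_x])
  have "has_pd_t K (pd_t K)" "has_pd_t P (pd_t P)"
    using has_pd_t_eq[OF K_t] has_pd_t_eq[OF P_t] K_t P_t by simp_all
  then have "((\<lambda>\<tau>. K x \<tau> * P x \<tau>) has_vector_derivative K x t * pd_t P x t + pd_t K x t * P x t) (at t)"
    by (intro has_vector_derivative_mult has_pd_tD)
  then have t: "pd_t (pd_x U1) x t = pd_t K x t * P x t + K x t * pd_t P x t"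
    by (simp add: x pd_t_def vector_derivative_at add.commute)
  have "pd_t K x t * P x t + K x t * pd_t P x t
      + (u1 x t + 2 * inverse (M x t) * cnj (c x t) * p x t)
      + \<i> / 2 * (K x t * (cnj (U1 x t) * U1 x t + cnj (U2 x t) * U2 x t) * P x t
      + (u1 x t + 2 * inverse (M x t) * cnj (c x t) * p x t)
        * (cnj (U1 x t) * (K x t * P x t) + cnj (U2 x t) * (K x t * P2 x t))) = 0"
    by (rule darboux_identity[OF _ K_def fun_cong[OF fun_cong[OF has_pd_t_eq[OF K_t]]] P_def
          fun_cong[OF fun_cong[OF has_pd_t_eq[OF P_t]]] K_norm inner_U_Ux])
      (use mu_nz in simp)
  then show ?thesis
    unfolding t by (simp add: x U1_def algebra_simps)
qed

text \<open>All conditions on \<open>c\<close> and \<open>M\<close> are symmetric in the two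
  components, so the second equation is the first one with the indices exchanged.\<close>

lemma swap: "FL_darboux u2 v2 u1 v1 mu c r p M"
  using mu_nz cnj_mu u1_x u2_x v1_t v2_t lax_swap[OF lax0] null M_x M_t M_cnj M_nz
  by unfold_locales (simp_all add: add.commute)

end

context FL_darboux
begin

interpretation swap: FL_darboux u2 v2 u1 v1 mu c r p M
  by (rule swap)

lemma solves: "solves_coupled_FL U1 U2"
proof -
  have H: "swap.H = H"
    by (auto simp: fun_eq_iff swap.H_def H_def)
  have U: "swap.U1 = U2" "swap.U2 = U1" and P: "swap.P = P2" "swap.P2 = P"
    by (auto simp: fun_eq_iff swap.U1_def swap.U2_def U1_def U2_def swap.P_def swap.P2_def P_def
        P2_def H)
  have x: "pd_x U1 = (\<lambda>x t. K x t * P x t)" "pd_x U2 = (\<lambda>x t. K x t * P2 x t)"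
    using has_pd_x_eq[OF U1_x] has_pd_x_eq[OF swap.U1_x] unfolding U P by this
  have norm: "complex_of_real ((cmod z)\<^sup>2 + (cmod w)\<^sup>2 / 2) = z * cnj z + w * cnj w / 2" for z w
    by (simp flip: complex_norm_square)
  show ?thesis
    unfolding solves_coupled_FL_def norm
  proof (intro allI conjI)
    fix x t
    show "pd_t (pd_x U1) x t + U1 x t
      + \<i> * (U1 x t * cnj (U1 x t) + U2 x t * cnj (U2 x t) / 2) * pd_x U1 x t
      + \<i> / 2 * U1 x t * cnj (U2 x t) * pd_x U2 x t = 0"
      using first_equation[of x t] by (simp add: x algebra_simps add_divide_distrib)
    show "pd_t (pd_x U2) x t + U2 x t
      + \<i> * (U2 x t * cnj (U2 x t) + U1 x t * cnj (U1 x t) / 2) * pd_x U2 x t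
      + \<i> / 2 * U2 x t * cnj (U1 x t) * pd_x U1 x t = 0"
      using swap.first_equation[of x t] by (simp add: x U P algebra_simps add_divide_distrib)
  qed
qed

end

section \<open>The potential M obtained from the mu-derivative of a Lax solution\<close>

locale FL_double_pole = FL_seed +
  fixes c p r d p' r' :: plane_fun and q :: complex
  assumes lax0: "lax mu u1 v1 u2 v2 c p r (\<lambda>x t. 0) (\<lambda>x t. 0)"
    and lax1: "lax mu u1 v1 u2 v2 d p' r'
      (\<lambda>x t. - (2 * \<i> / mu * c x t + (cnj (v1 x t) * p x t + cnj (v2 x t) * r x t) / mu) / mu)
      (\<lambda>x t. \<i> / 2 * c x t)"
    and null: "\<And>x t. mu * (c x t * cnj (c x t)) = p x t * cnj (p x t) + r x t * cnj (r x t)"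
    and c_nz: "\<And>x t. c x t \<noteq> 0"
    and q: "q \<notin> \<real>"
begin

lemmas lax0' = lax0[unfolded lax_def]
lemmas lax1' = lax1[unfolded lax_def]
lemmas x0 = lax0'[THEN conjunct1, THEN has_pd_xD]
  lax0'[THEN conjunct2, THEN conjunct1, THEN has_pd_xD]
  lax0'[THEN conjunct2, THEN conjunct2, THEN conjunct1, THEN has_pd_xD]
lemmas t0 = lax0'[THEN conjunct2, THEN conjunct2, THEN conjunct2, THEN conjunct1, THEN has_pd_tD]
  lax0'[THEN conjunct2, THEN conjunct2, THEN conjunct2, THEN conjunct2, THEN conjunct1, THEN has_pd_tD]
  lax0'[THEN conjunct2, THEN conjunct2, THEN conjunct2, THEN conjunct2, THEN conjunct2, THEN has_pd_tD]
lemmas x1 = lax1'[THEN conjunct1, THEN has_pd_xD]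
  lax1'[THEN conjunct2, THEN conjunct1, THEN has_pd_xD]
  lax1'[THEN conjunct2, THEN conjunct2, THEN conjunct1, THEN has_pd_xD]
lemmas t1 = lax1'[THEN conjunct2, THEN conjunct2, THEN conjunct2, THEN conjunct1, THEN has_pd_tD]
  lax1'[THEN conjunct2, THEN conjunct2, THEN conjunct2, THEN conjunct2, THEN conjunct1, THEN has_pd_tD]
  lax1'[THEN conjunct2, THEN conjunct2, THEN conjunct2, THEN conjunct2, THEN conjunct2, THEN has_pd_tD]

text \<open>\<open>(d, p', r')\<close> plays the role of the mu-derivative of
  \<open>(c, p, r)\<close>: the inhomogeneities in \<open>lax1\<close> are the mu-derivatives of the
  Lax coefficients. Then \<open>a\<close> is the J-product of the mu-derivative of (lambda c, p, r)
  with that vector itself; its first term comes from differentiating lambda = sqrt(mu).\<close>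

definition a :: plane_fun where
  "a x t = c x t * cnj (c x t) / 2
    + (mu * cnj (d x t) * c x t - cnj (p' x t) * p x t - cnj (r' x t) * r x t)"

text \<open>This is m_q / lambda_0: for an isotropic vector the K-norm is 2 mu |c|^2, which turns
  the last term of m_q into lambda_0 |c|^2.\<close>

definition M :: plane_fun where
  "M x t = 2 * (cnj q * a x t + q * cnj (a x t)) / (cnj q - q) - c x t * cnj (c x t)"

lemma cnj_q: "cnj q - q \<noteq> 0"
  using q by (auto simp: Reals_cnj_iff)

lemma sq_x: "((\<lambda>\<xi>. c \<xi> t * cnj (c \<xi> t)) has_vector_derivative
    (c x t * (cnj (p x t) * v1 x t + cnj (r x t) * v2 x t)
     + cnj (c x t) * (p x t * cnj (v1 x t) + r x t * cnj (v2 x t))) / mu) (at x)"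
  by (rule has_vector_derivative_eq_rhs, (rule derivative_intros x0)+)
    (simp add: mu_nz field_simps)

lemma sq_t: "((\<lambda>\<tau>. c x \<tau> * cnj (c x \<tau>)) has_vector_derivative
    \<i> / 2 * (c x t * (cnj (p x t) * u1 x t + cnj (r x t) * u2 x t)
     - cnj (c x t) * (p x t * cnj (u1 x t) + r x t * cnj (u2 x t)))) (at t)"
  by (rule has_vector_derivative_eq_rhs, (rule derivative_intros t0)+)
    (simp add: field_simps)

text \<open>The homogeneous parts of the two Lax systems are skew with respect to J and cancel,
  leaving the inhomogeneity and half the derivative of |c|^2. The result is purely imaginary. In
  twice it minus \<open>sq_x\<close> the conjugate halves cancel, which gives the one-sided formula
  for M_x.\<close>

lemma a_x: "((\<lambda>\<xi>. a \<xi> t) has_vector_derivative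
    2 * \<i> / mu * c x t * cnj (c x t)
    - (c x t * (cnj (p x t) * v1 x t + cnj (r x t) * v2 x t)
     - cnj (c x t) * (p x t * cnj (v1 x t) + r x t * cnj (v2 x t))) / (2 * mu)) (at x)"
  unfolding a_def
  by (rule has_vector_derivative_eq_rhs, (rule derivative_intros sq_x x0 x1)+)
    (simp add: mu_nz field_simps power2_eq_square)

lemma a_t: "((\<lambda>\<tau>. a x \<tau>) has_vector_derivative
    \<i> / 4 * (c x t * (cnj (p x t) * u1 x t + cnj (r x t) * u2 x t)
     + cnj (c x t) * (p x t * cnj (u1 x t) + r x t * cnj (u2 x t)))
    - \<i> / 2 * mu * c x t * cnj (c x t)) (at t)"
  unfolding a_def
  by (rule has_vector_derivative_eq_rhs, (rule derivative_intros sq_t t0 t1)+)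
    (simp add: field_simps)

text \<open>The free parameter \<open>q\<close> only weights the real part of \<open>a\<close>, which is constant.\<close>

lemma antihermitian_part:
  assumes "((\<lambda>s. f s) has_vector_derivative f') (at s)" "cnj f' = - f'"
  shows "((\<lambda>s. 2 * (cnj q * f s + q * cnj (f s)) / (cnj q - q)) has_vector_derivative 2 * f') (at s)"
proof -
  have "2 * (cnj q * f' + q * cnj f') / (cnj q - q) = 2 * f'"
    using cnj_q assms(2) by (simp add: field_simps)
  moreover have "((\<lambda>s. 2 * (cnj q * f s + q * cnj (f s)) / (cnj q - q)) has_vector_derivative
    2 * (cnj q * f' + q * cnj f') / (cnj q - q)) (at s)"
    by (rule has_vector_derivative_eq_rhs, (rule derivative_intros assms(1))+) (rule refl)
  ultimately show ?thesis by metis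
qed

text \<open>The q-dependent term is a real number divided by an imaginary one, so only - |c|^2
  contributes to the real part.\<close>

lemma M_cnj: "M x t + cnj (M x t) = - 2 * c x t * cnj (c x t)"
proof -
  define w n where "w = cnj q - q" and "n = 2 * (cnj q * a x t + q * cnj (a x t))"
  have "cnj w = - w" "cnj n = n"
    by (simp_all add: w_def n_def algebra_simps)
  then have "cnj (n / w) = - (n / w)" by simp
  then show ?thesis
    unfolding M_def w_def[symmetric] n_def[symmetric] by (simp add: algebra_simps)
qed

lemma M_nz: "M x t \<noteq> 0"
  using M_cnj[of x t] c_nz[of x t] by auto

sublocale FL_darboux u1 v1 u2 v2 mu c p r M
proof
  show "has_pd_x M (\<lambda>x t. 4 * \<i> / mu * c x t * cnj (c x t)
      - 2 / mu * c x t * (cnj (p x t) * v1 x t + cnj (r x t) * v2 x t))"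
    unfolding has_pd_x_def M_def
    by (intro allI, rule has_vector_derivative_eq_rhs,
        rule has_vector_derivative_diff[OF antihermitian_part[OF a_x] sq_x])
      (simp_all add: mu_nz field_simps)
  show "has_pd_t M (\<lambda>x t. \<i> * cnj (c x t) * (cnj (u1 x t) * p x t + cnj (u2 x t) * r x t)
      - \<i> * mu * c x t * cnj (c x t))"
    unfolding has_pd_t_def M_def
    by (intro allI, rule has_vector_derivative_eq_rhs,
        rule has_vector_derivative_diff[OF antihermitian_part[OF a_t] sq_t])
      (simp_all add: field_simps)
qed (use lax0 null M_cnj M_nz in auto)

lemma Re_M: "Re (M x t) = - (cmod (c x t))\<^sup>2"
  using arg_cong[OF M_cnj[of x t], of Re]
  unfolding cmod_power2 by (simp add: power2_eq_square)

end

section \<open>Derivatives in the spectral variable\<close>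

text \<open>The induction differentiates an equality of functions, so it has to hold on the open set
  \<open>T\<close> and not just at the point.\<close>

lemma nth_deriv_eq:
  assumes "open T"
    and "\<And>j z. j < n \<Longrightarrow> z \<in> T \<Longrightarrow> (f j has_vector_derivative f (Suc j) z) (at z)"
    and "z \<in> T"
  shows "nth_deriv n (f 0) z = f n z"
  using assms(2,3)
proof (induction n arbitrary: z)
  case 0
  then show ?case by (simp add: nth_deriv_def)
next
  case (Suc n)
  have "(f n has_vector_derivative f (Suc n) z) (at z)"
    using Suc.prems by simp
  then have "(nth_deriv n (f 0) has_vector_derivative f (Suc n) z) (at z)"
    by (rule has_vector_derivative_transform_within_open[OF _ assms(1)])
      (use Suc in auto)
  then show ?case by (simp add: nth_deriv_def vector_derivative_at)
qed

lemma vector_3_axis: "(vector [a, b, c] :: complex^3) = axis 1 a + axis 2 b + axis 3 c"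
  by (simp add: vec_eq_iff forall_3 axis_def)

lemma bounded_linear_axis: "bounded_linear (axis i :: complex \<Rightarrow> complex^3)"
  unfolding linear_conv_bounded_linear[symmetric]
  by (rule linearI) (simp_all add: axis_def vec_eq_iff)

lemma has_vector_derivative_vector_3:
  assumes "(f has_vector_derivative f') (at z)" "(g has_vector_derivative g') (at z)"
    "(h has_vector_derivative h') (at z)"
  shows "((\<lambda>z. vector [f z, g z, h z] :: complex^3) has_vector_derivative vector [f', g', h']) (at z)"
  unfolding vector_3_axis
  by (intro has_vector_derivative_add bounded_linear.has_vector_derivative[OF bounded_linear_axis] assms)

text \<open>If \<open>h\<close> and \<open>e\<close> list the successive derivatives of two functions, then \<open>conv h e\<close> lists those of their
  product.\<close>

definition conv :: "(nat \<Rightarrow> complex) \<Rightarrow> (nat \<Rightarrow> complex) \<Rightarrow> nat \<Rightarrow> complex" where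
  "conv h e n = (\<Sum>j\<le>n. of_nat (n choose j) * h j * e (n - j))"

lemma conv_simps:
  "conv h e 0 = h 0 * e 0"
  "conv h e (Suc 0) = h 0 * e 1 + h 1 * e 0"
  "conv h e 2 = h 0 * e 2 + 2 * h 1 * e 1 + h 2 * e 0"
  "conv h e 3 = h 0 * e 3 + 3 * h 1 * e 2 + 3 * h 2 * e 1 + h 3 * e 0"
  by (simp_all add: conv_def numeral_eq_Suc)

lemma le3_cases: "n \<le> 3 \<Longrightarrow> n = 0 \<or> n = Suc 0 \<or> n = 2 \<or> n = 3" for n :: nat
  by linarith

lemma has_vector_derivative_conv:
  assumes "\<And>j. j \<le> n \<Longrightarrow> ((\<lambda>s. e j s) has_vector_derivative e' j) (at s)"
  shows "((\<lambda>s. conv h (\<lambda>j. e j s) n) has_vector_derivative conv h e' n) (at s)"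
  unfolding conv_def using assms
  by (intro has_vector_derivative_sum has_vector_derivative_mult_right) auto

text \<open>\<open>h\<^sub>1\<close> and \<open>h\<^sub>2\<close> are both of the form \<open>w / (w + z)\<close>, with \<open>w = k\<close> and \<open>w = - k\<close>; these are its
  derivatives in \<open>z\<close>.\<close>

definition hj :: "real \<Rightarrow> nat \<Rightarrow> real \<Rightarrow> real" where
  "hj w j z = (-1) ^ j * fact j * w / (w + z) ^ Suc j"

lemma hj_deriv: "w + z \<noteq> 0 \<Longrightarrow> (hj w j has_real_derivative hj w (Suc j) z) (at z)"
  unfolding hj_def
  by (rule derivative_eq_intros refl | simp)+

definition hc :: "real \<Rightarrow> real \<Rightarrow> nat \<Rightarrow> complex" where "hc w z j = of_real (hj w j z)"

context FL_double_root
begin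

definition nuj :: "nat \<Rightarrow> real \<Rightarrow> real" where
  "nuj j z = (if j = 0 then S / 2 else 0) + (-1) ^ j * fact j * (2 - k * R) / (2 * z ^ Suc j)"

text \<open>For \<open>j \<ge> 1\<close> this is the j-th z-derivative of the phase i (z x + nu(z)
  t). At \<open>j = 0\<close> the summand z x is absent, hence the hypothesis \<open>j > 0\<close>
  in \<open>th_deriv\<close>.\<close>

definition th :: "nat \<Rightarrow> real \<Rightarrow> real \<Rightarrow> real \<Rightarrow> complex" where
  "th j z x t = \<i> * of_real ((if j = 1 then 1 else 0) * x + nuj j z * t)"

text \<open>The prefactors are the complete Bell polynomials of orders 0 to 3 in the derivatives of
  the phase. The last branch catches every larger index, so the statements below carry
  \<open>n < 3\<close> or \<open>n \<le> 3\<close>.\<close>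

definition Ej :: "nat \<Rightarrow> real \<Rightarrow> real \<Rightarrow> real \<Rightarrow> complex" where
  "Ej n z x t =
    (if n = 0 then 1 else if n = 1 then th 1 z x t
     else if n = 2 then th 2 z x t + (th 1 z x t)\<^sup>2
     else th 3 z x t + 3 * th 1 z x t * th 2 z x t + (th 1 z x t) ^ 3) * E z x t"

lemma Ej_simps:
  "Ej 0 z x t = E z x t"
  "Ej (Suc 0) z x t = th 1 z x t * E z x t"
  "Ej 2 z x t = (th 2 z x t + (th 1 z x t)\<^sup>2) * E z x t"
  "Ej 3 z x t = (th 3 z x t + 3 * th 1 z x t * th 2 z x t + (th 1 z x t) ^ 3) * E z x t"
  by (simp_all add: Ej_def)

lemma nuj_deriv: "z \<noteq> 0 \<Longrightarrow> (nuj j has_real_derivative nuj (Suc j) z) (at z)"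
  unfolding nuj_def
  by (rule derivative_eq_intros refl | simp)+
    (simp add: field_simps power2_eq_square)

lemma E_deriv: "z \<noteq> 0 \<Longrightarrow> ((\<lambda>z. E z x t) has_vector_derivative th 1 z x t * E z x t) (at z)"
proof -
  assume "z \<noteq> 0"
  have "E z x t = exp (\<i> * of_real (z * x + nuj 0 z * t))" for z
    by (simp add: E_def nuj_def nu_def)
  then show ?thesis
    using nuj_deriv[OF \<open>z \<noteq> 0\<close>, of 0] unfolding th_def
    by (auto intro!: derivative_eq_intros simp: algebra_simps)
qed

lemma th_deriv:
  "z \<noteq> 0 \<Longrightarrow> j > 0 \<Longrightarrow> ((\<lambda>z. th j z x t) has_vector_derivative th (Suc j) z x t) (at z)"
  unfolding th_def by (auto intro!: derivative_eq_intros nuj_deriv)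

lemma Ej_deriv:
  assumes "z \<noteq> 0" "n < 3"
  shows "((\<lambda>z. Ej n z x t) has_vector_derivative Ej (Suc n) z x t) (at z)"
proof -
  have th: "((\<lambda>z. th 1 z x t) has_vector_derivative th 2 z x t) (at z)"
    "((\<lambda>z. th 2 z x t) has_vector_derivative th 3 z x t) (at z)"
    using th_deriv[OF assms(1), of 1] th_deriv[OF assms(1), of 2] by (simp_all add: numeral_eq_Suc)
  consider "n = 0" | "n = Suc 0" | "n = 2" using assms(2) by linarith
  then show ?thesis
  proof cases
    case 1
    then show ?thesis using E_deriv[OF assms(1)] by (simp add: Ej_simps)
  next
    case 2
    then have n: "n = Suc 0" "Suc n = 2" by auto
    show ?thesis unfolding n(2) Ej_simps unfolding n(1) Ej_simps
      by (rule has_vector_derivative_eq_rhs, (rule derivative_intros th E_deriv assms)+)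
        (simp add: algebra_simps power2_eq_square)
  next
    case 3
    then have n: "n = 2" "Suc n = 3" by auto
    show ?thesis unfolding n(2) Ej_simps unfolding n(1) Ej_simps power2_eq_square
      by (rule has_vector_derivative_eq_rhs, (rule derivative_intros th E_deriv assms)+)
        (simp add: algebra_simps power2_eq_square power3_eq_cube)
  qed
qed

definition nuc :: "real \<Rightarrow> nat \<Rightarrow> complex" where "nuc z j = of_real (nuj j z)"

definition yj :: "nat \<Rightarrow> real \<Rightarrow> real \<Rightarrow> real \<Rightarrow> complex^3" where
  "yj n z x t = vector [of_real lam0 * Ej n z x t,
     u10 x t * conv (hc k z) (\<lambda>j. Ej j z x t) n, u20 x t * conv (hc (- k) z) (\<lambda>j. Ej j z x t) n]"

lemma conv_deriv:
  assumes "n < 3" "\<And>j. j \<le> n \<Longrightarrow> ((\<lambda>z. h z j) has_vector_derivative h z (Suc j)) (at z)"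
    "\<And>j. j \<le> n \<Longrightarrow> ((\<lambda>z. e j z) has_vector_derivative e (Suc j) z) (at z)"
  shows "((\<lambda>z. conv (h z) (\<lambda>j. e j z) n) has_vector_derivative conv (h z) (\<lambda>j. e j z) (Suc n)) (at z)"
proof -
  have h: "((\<lambda>z. h z j) has_vector_derivative h z m) (at z)" if "j \<le> n" "m = Suc j" for j m
    using assms(2) that by simp
  have e: "((\<lambda>z. e j z) has_vector_derivative e m z) (at z)" if "j \<le> n" "m = Suc j" for j m
    using assms(3) that by simp
  consider "n = 0" "Suc n = Suc 0" | "n = Suc 0" "Suc n = 2" | "n = 2" "Suc n = 3"
    using assms(1) by linarith
  then show ?thesis
  proof cases
    case 1
    note d = h[of 0 1] e[of 0 1]
    show ?thesis unfolding 1(2) conv_simps unfolding 1(1) conv_simps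
      by (rule has_vector_derivative_eq_rhs, (rule derivative_intros d | (simp add: 1; fail))+)
  next
    case 2
    note d = h[of 0 1] e[of 0 1] h[of 1 2] e[of 1 2]
    show ?thesis unfolding 2(2) conv_simps unfolding 2(1) conv_simps
      by (rule has_vector_derivative_eq_rhs, (rule derivative_intros d | (simp add: 2; fail))+)
  next
    case 3
    note d = h[of 0 1] e[of 0 1] h[of 1 2] e[of 1 2] h[of 2 3] e[of 2 3]
    show ?thesis unfolding 3(2) conv_simps unfolding 3(1) conv_simps
      by (rule has_vector_derivative_eq_rhs, (rule derivative_intros d | (simp add: 3; fail))+)
  qed
qed

lemma yj_deriv:
  assumes "z \<noteq> 0" "k + z \<noteq> 0" "- k + z \<noteq> 0" "n < 3"
  shows "((\<lambda>z. yj n z x t) has_vector_derivative yj (Suc n) z x t) (at z)"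
  unfolding yj_def
proof (intro has_vector_derivative_vector_3 has_vector_derivative_mult_right conv_deriv)
  show "((\<lambda>z. hc k z j) has_vector_derivative hc k z (Suc j)) (at z)"
    "((\<lambda>z. hc (- k) z j) has_vector_derivative hc (- k) z (Suc j)) (at z)" for j
    unfolding hc_def using assms by (intro has_vector_derivative_of_real hj_deriv; simp)+
qed (use assms in \<open>auto intro!: Ej_deriv\<close>)

lemma y_eq_yj: "y z lam0 x t = yj 0 z x t"
proof -
  have "- k / (- k + z) = k / (k - z)"
    by (metis minus_diff_eq minus_divide_divide uminus_add_conv_diff)
  then have "hj k 0 z = h1 z" "hj (- k) 0 z = h2 z"
    by (simp_all add: hj_def h1_def h2_def)
  then show ?thesis by (simp add: y_def yj_def conv_simps Ej_simps hc_def mult.assoc)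
qed

lemma nth_deriv_y:
  assumes "z \<noteq> 0" "k + z \<noteq> 0" "- k + z \<noteq> 0" "n \<le> 3"
  shows "nth_deriv n (\<lambda>z. y z lam0 x t) z = yj n z x t"
proof -
  have "nth_deriv n ((\<lambda>n z. yj n z x t) 0) z = yj n z x t"
  proof (rule nth_deriv_eq[where T = "- {0, k, - k}"])
    show "open (- {0, k, - k})" by (intro open_Compl finite_imp_closed) simp
  qed (use assms in \<open>auto intro!: yj_deriv simp: add_eq_0_iff2\<close>)
  then show ?thesis by (simp add: y_eq_yj)
qed

lemma nth_deriv_E:
  assumes "z \<noteq> 0" "n \<le> 3"
  shows "nth_deriv n (\<lambda>z. E z x t) z = Ej n z x t"
proof -
  have "nth_deriv n ((\<lambda>n z. Ej n z x t) 0) z = Ej n z x t"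
    by (rule nth_deriv_eq[where T = "- {0}"]) (use assms in \<open>auto intro!: Ej_deriv\<close>)
  then show ?thesis by (simp add: Ej_simps)
qed

end

text \<open>This is the n-th z-derivative of (w + z) h e = w e, for h = w / (w + z);
  \<open>z * e j + of_nat j * e (j - 1)\<close> is the j-th derivative of z e. At
  \<open>j = 0\<close> the factor \<open>of_nat 0\<close> removes the truncated index.\<close>

lemma conv_shift:
  assumes "(w + z) * h 0 = w" "\<And>j. (w + z) * h (Suc j) = - of_nat (Suc j) * h j" "n \<le> 3"
  shows "w * conv h e n + conv h (\<lambda>j. z * e j + of_nat j * e (j - 1)) n = w * e n"
proof -
  have h: "(w + z) * h 1 = - h 0" "(w + z) * h 2 = - 2 * h 1" "(w + z) * h 3 = - 3 * h 2"
    using assms(2)[of 0] assms(2)[of 1] assms(2)[of 2] by (simp_all add: numeral_eq_Suc)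
  from le3_cases[OF assms(3)] show ?thesis
  proof (elim disjE)
    assume n: "n = 0"
    have "?thesis \<longleftrightarrow> ((w + z) * h 0) * e 0 = w * e 0"
      by (simp add: n conv_simps algebra_simps)
    then show ?thesis by (simp add: assms(1))
  next
    assume n: "n = Suc 0"
    have "w * conv h e n + conv h (\<lambda>j. z * e j + of_nat j * e (j - 1)) n
      = ((w + z) * h 0) * e 1 + ((w + z) * h 1 + h 0) * e 0"
      by (simp add: n conv_simps algebra_simps)
    then show ?thesis unfolding assms(1) h by (simp add: n)
  next
    assume n: "n = 2"
    have "w * conv h e n + conv h (\<lambda>j. z * e j + of_nat j * e (j - 1)) n
      = ((w + z) * h 0) * e 2 + 2 * ((w + z) * h 1 + h 0) * e 1 + ((w + z) * h 2 + 2 * h 1) * e 0"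
      by (simp add: n conv_simps algebra_simps)
    then show ?thesis unfolding assms(1) h by (simp add: n)
  next
    assume n: "n = 3"
    have "w * conv h e n + conv h (\<lambda>j. z * e j + of_nat j * e (j - 1)) n
      = ((w + z) * h 0) * e 3 + 3 * ((w + z) * h 1 + h 0) * e 2 + 3 * ((w + z) * h 2 + 2 * h 1) * e 1
        + ((w + z) * h 3 + 3 * h 2) * e 0"
      by (simp add: n conv_simps algebra_simps)
    then show ?thesis unfolding assms(1) h by (simp add: n)
  qed
qed

lemma conv_assoc:
  assumes "n \<le> 3"
  shows "conv h (\<lambda>j. conv v e j) n = conv (conv h v) e n"
  using le3_cases[OF assms]
  by (elim disjE) (simp_all add: conv_simps One_nat_def[symmetric] algebra_simps del: One_nat_def,
    simp_all add: conv_simps algebra_simps)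

lemma conv_add_left: "conv (\<lambda>j. h j + h' j) e n = conv h e n + conv h' e n"
  by (simp add: conv_def algebra_simps sum.distrib)

lemma conv_cmult_left: "conv (\<lambda>j. a * h j) e n = a * conv h e n"
  by (simp add: conv_def algebra_simps sum_distrib_left)

lemma conv_cmult_right: "conv h (\<lambda>j. a * e j) n = a * conv h e n"
  by (simp add: conv_def algebra_simps sum_distrib_left)

lemma conv_cong: "(\<And>j. j \<le> n \<Longrightarrow> h j = h' j) \<Longrightarrow> conv h e n = conv h' e n"
  by (simp add: conv_def)

context FL_double_root
begin

definition v10 :: plane_fun where "v10 x t = \<i> * of_real k * u10 x t"
definition v20 :: plane_fun where "v20 x t = - \<i> * of_real k * u20 x t"

lemma hc_shift:
  assumes "w + z \<noteq> 0"
  shows "(of_real w + of_real z) * hc w z 0 = of_real w"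
    "(of_real w + of_real z) * hc w z (Suc j) = - of_nat (Suc j) * hc w z j"
proof -
  have "(w + z) * hj w 0 z = w" "(w + z) * hj w (Suc j) z = - (real (Suc j)) * hj w j z"
    using assms by (simp_all add: hj_def divide_simps) (simp_all add: algebra_simps)
  from this[THEN arg_cong[of _ _ complex_of_real]]
  show "(of_real w + of_real z) * hc w z 0 = of_real w"
    "(of_real w + of_real z) * hc w z (Suc j) = - of_nat (Suc j) * hc w z j"
    by (simp_all add: hc_def)
qed

text \<open>With \<open>p = 1 / (w + z)\<close> and \<open>s = 1 / z\<close> this is \<open>w p s = s - p\<close>, differentiated in \<open>z\<close>.\<close>

lemma hc_conv_pole:
  assumes "w \<noteq> 0" "w + z \<noteq> 0" "z \<noteq> 0" "n \<le> 3"
  shows "hc w z n / of_real w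
    + conv (hc w z) (\<lambda>j. (-1) ^ j * fact j / of_real z ^ Suc j) n = (-1) ^ n * fact n / of_real z ^ Suc n"
proof -
  define p s :: complex where "p = 1 / of_real (w + z)" and "s = 1 / of_real z"
  have r: "of_real w * p * s = s - p"
  proof -
    have "w * (1 / (w + z)) * (1 / z) = 1 / z - 1 / (w + z)"
      using assms by (simp add: field_simps)
    from arg_cong[OF this, of complex_of_real] show ?thesis by (simp add: p_def s_def)
  qed
  have h: "hc w z = (\<lambda>j. of_real w * ((-1) ^ j * fact j * p ^ Suc j))"
    by (rule ext) (simp add: hc_def hj_def p_def power_divide)
  have v: "(-1) ^ j * fact j / of_real z ^ Suc j = (-1) ^ j * fact j * s ^ Suc j" for j
    by (simp add: s_def power_divide)
  have "(-1) ^ n * fact n * p ^ Suc n + conv (\<lambda>j. of_real w * ((-1) ^ j * fact j * p ^ Suc j))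
      (\<lambda>j. (-1) ^ j * fact j * s ^ Suc j) n = (-1) ^ n * fact n * s ^ Suc n"
    using le3_cases[OF assms(4)]
  proof (elim disjE)
    assume n: "n = 0" show ?thesis using r by (simp add: n conv_simps)
  next
    assume n: "n = Suc 0" show ?thesis using r by (simp add: n conv_simps) algebra
  next
    assume n: "n = 2" show ?thesis using r by (simp add: n conv_simps fact_numeral) algebra
  next
    assume n: "n = 3" show ?thesis using r by (simp add: n conv_simps fact_numeral) algebra
  qed
  then show ?thesis using assms(1) unfolding v by (simp add: h)
qed

lemma th_x: "((\<lambda>\<xi>. th j z \<xi> t) has_vector_derivative (if j = 1 then \<i> else 0)) (at x)"
  unfolding th_def by (auto intro!: derivative_eq_intros)

lemma th_t: "((\<lambda>\<tau>. th j z x \<tau>) has_vector_derivative \<i> * nuc z j) (at t)"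
  unfolding th_def nuc_def by (auto intro!: derivative_eq_intros)

lemma E_x: "((\<lambda>\<xi>. E z \<xi> t) has_vector_derivative \<i> * of_real z * E z x t) (at x)"
  unfolding E_def by (auto intro!: derivative_eq_intros)

lemma E_t: "((\<lambda>\<tau>. E z x \<tau>) has_vector_derivative \<i> * nuc z 0 * E z x t) (at t)"
proof -
  have "nuj 0 z = nu z" by (simp add: nuj_def nu_def)
  then show ?thesis unfolding E_def nuc_def by (auto intro!: derivative_eq_intros)
qed

lemma Ej_x:
  assumes "n \<le> 3"
  shows "((\<lambda>\<xi>. Ej n z \<xi> t) has_vector_derivative
    \<i> * (of_real z * Ej n z x t + of_nat n * Ej (n - 1) z x t)) (at x)"
proof -
  from le3_cases[OF assms] show ?thesis
  proof (elim disjE)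
    assume n: "n = 0" show ?thesis unfolding n Ej_simps
      by (rule has_vector_derivative_eq_rhs, rule E_x) simp
  next
    assume n: "n = Suc 0" show ?thesis unfolding n Ej_simps
      by (rule has_vector_derivative_eq_rhs, (rule derivative_intros E_x th_x)+)
        (simp add: Ej_simps algebra_simps)
  next
    assume n: "n = 2" show ?thesis unfolding n Ej_simps power2_eq_square
      by (rule has_vector_derivative_eq_rhs, (rule derivative_intros E_x th_x)+)
        (simp add: Ej_simps algebra_simps)
  next
    assume n: "n = 3" show ?thesis unfolding n Ej_simps power3_eq_cube
      by (rule has_vector_derivative_eq_rhs, (rule derivative_intros E_x th_x)+)
        (simp add: Ej_simps power2_eq_square algebra_simps)
  qed
qed

lemma Ej_t:
  assumes "n \<le> 3"
  shows "((\<lambda>\<tau>. Ej n z x \<tau>) has_vector_derivative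
    \<i> * conv (nuc z) (\<lambda>j. Ej j z x t) n) (at t)"
  using le3_cases[OF assms]
proof (elim disjE)
  assume n: "n = 0" show ?thesis unfolding n conv_simps Ej_simps
    by (rule has_vector_derivative_eq_rhs, rule E_t) simp
next
  assume n: "n = Suc 0" show ?thesis unfolding n conv_simps Ej_simps
    by (rule has_vector_derivative_eq_rhs, (rule derivative_intros E_t th_t)+)
      (simp add: Ej_simps algebra_simps)
next
  assume n: "n = 2" show ?thesis unfolding n conv_simps Ej_simps power2_eq_square
    by (rule has_vector_derivative_eq_rhs, (rule derivative_intros E_t th_t)+)
      (simp add: Ej_simps algebra_simps)
next
  assume n: "n = 3" show ?thesis unfolding n conv_simps Ej_simps power3_eq_cube power2_eq_square
    by (rule has_vector_derivative_eq_rhs, (rule derivative_intros E_t th_t)+)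
      (simp add: Ej_simps algebra_simps)
qed

text \<open>The Lax residuals of the vector \<open>y\<close> at spectral parameter \<open>mu\<close>: the function
  \<open>z (mu - Lam z)\<close> in the \<open>x\<close>-part and \<open>mu - Lam z\<close> in the \<open>t\<close>-part, with their derivatives in \<open>z\<close>,
  written without division by \<open>z\<close> in the first case.\<close>

definition G :: "real \<Rightarrow> nat \<Rightarrow> real \<Rightarrow> real" where
  "G mu j z = (if j = 0 then mu * z - 2 else if j = 1 then mu else 0) + k * A * hj k j z - k * B * hj (- k) j z"

definition H :: "real \<Rightarrow> nat \<Rightarrow> real \<Rightarrow> real" where
  "H mu j z = (if j = 0 then mu + S else 0) - A * hj k j z - B * hj (- k) j z - 2 * nuj j z"

end

section \<open>The plane-wave background and the Lax residuals of y and its z-derivatives\<close>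

locale FL_background = FL_double_root +
  assumes a1_sq: "a1\<^sup>2 = A" and a2_sq: "a2\<^sup>2 = B" and k_nz: "k \<noteq> 0"
begin

lemma u10_sq: "cnj (u10 x t) * u10 x t = of_real A"
proof -
  have "cmod (u10 x t) = \<bar>a1\<bar>" by (simp add: u10_def norm_mult)
  then show ?thesis
    using complex_norm_square[of "u10 x t"] a1_sq by (simp add: mult.commute)
qed

lemma u20_sq: "cnj (u20 x t) * u20 x t = of_real B"
proof -
  have "cmod (u20 x t) = \<bar>a2\<bar>"
    unfolding u20_def norm_mult norm_exp_i_times by simp
  then show ?thesis
    using complex_norm_square[of "u20 x t"] a2_sq by (simp add: mult.commute)
qed

lemma u10_x: "((\<lambda>\<xi>. u10 \<xi> t) has_vector_derivative \<i> * of_real k * u10 x t) (at x)"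
  unfolding u10_def by (auto intro!: derivative_eq_intros)

lemma u10_t: "((\<lambda>\<tau>. u10 x \<tau>) has_vector_derivative \<i> * of_real omega1 * u10 x t) (at t)"
  unfolding u10_def by (auto intro!: derivative_eq_intros)

lemma u20_x: "((\<lambda>\<xi>. u20 \<xi> t) has_vector_derivative - \<i> * of_real k * u20 x t) (at x)"
  unfolding u20_def by (auto intro!: derivative_eq_intros)

lemma u20_t: "((\<lambda>\<tau>. u20 x \<tau>) has_vector_derivative \<i> * of_real omega2 * u20 x t) (at t)"
  unfolding u20_def by (auto intro!: derivative_eq_intros)

lemma seed:
  assumes "mu > 0"
  shows "FL_seed u10 v10 u20 v20 (of_real mu)"
proof
  show "has_pd_x u10 v10" "has_pd_x u20 v20"
    using u10_x u20_x by (simp_all add: has_pd_x_def v10_def v20_def)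
  have 1: "cnj (u10 x t) * v10 x t = \<i> * of_real k * of_real A" for x t
    using u10_sq[of x t] by (simp add: v10_def)
  have 2: "cnj (u20 x t) * v20 x t = - \<i> * of_real k * of_real B" for x t
    using u20_sq[of x t] by (simp add: v20_def)
  show "has_pd_t v10 (\<lambda>x t. - u10 x t
      - \<i> / 2 * ((cnj (u10 x t) * u10 x t + cnj (u20 x t) * u20 x t) * v10 x t
               + u10 x t * (cnj (u10 x t) * v10 x t + cnj (u20 x t) * v20 x t)))"
    unfolding has_pd_t_def 1 2 u10_sq u20_sq unfolding v10_def
    by (intro allI, rule has_vector_derivative_eq_rhs, (rule derivative_intros u10_t)+)
      (simp add: omega1_def field_simps k_nz)
  show "has_pd_t v20 (\<lambda>x t. - u20 x t
      - \<i> / 2 * ((cnj (u10 x t) * u10 x t + cnj (u20 x t) * u20 x t) * v20 x t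
               + u20 x t * (cnj (u10 x t) * v10 x t + cnj (u20 x t) * v20 x t)))"
    unfolding has_pd_t_def 1 2 u10_sq u20_sq unfolding v20_def
    by (intro allI, rule has_vector_derivative_eq_rhs, (rule derivative_intros u20_t)+)
      (simp add: omega2_def field_simps k_nz)
qed (use assms in auto)

text \<open>This is (om + nu) h = nu - S / 2 differentiated in z. The undifferentiated form is (1 /
  w + 1 / z) w / (w + z) = 1 / z, up to the constant (2 - k R) / 2.\<close>

lemma hc_nu:
  assumes "w \<noteq> 0" "w + z \<noteq> 0" "z \<noteq> 0" "n \<le> 3" "om = (2 - k * R) / (2 * w) - S / 2"
  shows "of_real om * hc w z n + conv (hc w z) (nuc z) n = nuc z n - (if n = 0 then of_real (S / 2) else 0)"
proof -
  define C :: complex where "C = of_real ((2 - k * R) / 2)"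
  define N where "N j = (-1) ^ j * fact j / complex_of_real z ^ Suc j" for j
  have nu: "nuc z j = (if j = 0 then of_real (S / 2) else 0) + C * N j" for j
    by (simp add: nuc_def nuj_def C_def N_def)
  have "conv (hc w z) (nuc z) n = of_real (S / 2) * hc w z n + C * conv (hc w z) N n"
    using le3_cases[OF assms(4)] by (elim disjE) (simp_all add: conv_simps nu algebra_simps)
  moreover have om: "complex_of_real om = C / of_real w - of_real (S / 2)"
    by (simp add: assms(5) C_def)
  moreover have "C * (hc w z n / of_real w + conv (hc w z) N n) = C * N n"
    using hc_conv_pole[OF assms(1-4)] by (simp add: N_def[abs_def])
  ultimately show ?thesis unfolding om by (simp add: nu algebra_simps)
qed

text \<open>Both frequencies are one expression in w, taken at w = k and w = - k, so
  \<open>component_t\<close> serves both components.\<close>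

lemma omega: "omega1 = (2 - k * R) / (2 * k) - S / 2" "omega2 = (2 - k * R) / (2 * - k) - S / 2"
  using k_nz by (simp_all add: omega1_def omega2_def S_def R_def field_simps)

lemma conv_Ej_x:
  assumes "n \<le> 3"
  shows "((\<lambda>\<xi>. conv h (\<lambda>j. Ej j z \<xi> t) n) has_vector_derivative
    \<i> * conv h (\<lambda>j. of_real z * Ej j z x t + of_nat j * Ej (j - 1) z x t) n) (at x)"
  unfolding conv_cmult_right[symmetric]
  by (rule has_vector_derivative_conv, rule Ej_x) (use assms in simp)

lemma conv_Ej_t:
  assumes "n \<le> 3"
  shows "((\<lambda>\<tau>. conv h (\<lambda>j. Ej j z x \<tau>) n) has_vector_derivative
    \<i> * conv (conv h (nuc z)) (\<lambda>j. Ej j z x t) n) (at t)"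
  by (rule has_vector_derivative_eq_rhs, rule has_vector_derivative_conv, rule Ej_t)
    (use assms in \<open>simp_all add: conv_cmult_right conv_assoc\<close>)

lemma component_x:
  assumes "((\<lambda>\<xi>. u \<xi> t) has_vector_derivative \<i> * of_real w * u x t) (at x)"
    and "w + z \<noteq> 0" "n \<le> 3"
  shows "((\<lambda>\<xi>. u \<xi> t * conv (hc w z) (\<lambda>j. Ej j z \<xi> t) n) has_vector_derivative
    \<i> * of_real w * u x t * Ej n z x t) (at x)"
proof (rule has_vector_derivative_eq_rhs)
  show "((\<lambda>\<xi>. u \<xi> t * conv (hc w z) (\<lambda>j. Ej j z \<xi> t) n) has_vector_derivative
      u x t * (\<i> * conv (hc w z) (\<lambda>j. of_real z * Ej j z x t + of_nat j * Ej (j - 1) z x t) n)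
      + \<i> * of_real w * u x t * conv (hc w z) (\<lambda>j. Ej j z x t) n) (at x)"
    by (intro has_vector_derivative_mult assms(1) conv_Ej_x assms(3))
  have "of_real w * conv (hc w z) (\<lambda>j. Ej j z x t) n
      + conv (hc w z) (\<lambda>j. of_real z * Ej j z x t + of_nat j * Ej (j - 1) z x t) n = of_real w * Ej n z x t"
    by (rule conv_shift) (use hc_shift[OF assms(2)] assms(3) in auto)
  from arg_cong[OF this, of "\<lambda>e. \<i> * u x t * e"]
  show "u x t * (\<i> * conv (hc w z) (\<lambda>j. of_real z * Ej j z x t + of_nat j * Ej (j - 1) z x t) n)
      + \<i> * of_real w * u x t * conv (hc w z) (\<lambda>j. Ej j z x t) n = \<i> * of_real w * u x t * Ej n z x t"
    by (simp add: algebra_simps)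
qed

lemma component_t:
  assumes "((\<lambda>\<tau>. u x \<tau>) has_vector_derivative \<i> * of_real om * u x t) (at t)"
    and "om = (2 - k * R) / (2 * w) - S / 2" "w \<noteq> 0" "w + z \<noteq> 0" "z \<noteq> 0" "n \<le> 3"
  shows "((\<lambda>\<tau>. u x \<tau> * conv (hc w z) (\<lambda>j. Ej j z x \<tau>) n) has_vector_derivative
    \<i> * u x t * (conv (nuc z) (\<lambda>j. Ej j z x t) n - of_real (S / 2) * Ej n z x t)) (at t)"
proof (rule has_vector_derivative_eq_rhs)
  show "((\<lambda>\<tau>. u x \<tau> * conv (hc w z) (\<lambda>j. Ej j z x \<tau>) n) has_vector_derivative
      u x t * (\<i> * conv (conv (hc w z) (nuc z)) (\<lambda>j. Ej j z x t) n)
      + \<i> * of_real om * u x t * conv (hc w z) (\<lambda>j. Ej j z x t) n) (at t)"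
    by (intro has_vector_derivative_mult assms(1) conv_Ej_t assms(6))
  have "of_real om * conv (hc w z) (\<lambda>j. Ej j z x t) n + conv (conv (hc w z) (nuc z)) (\<lambda>j. Ej j z x t) n
    = conv (\<lambda>j. of_real om * hc w z j + conv (hc w z) (nuc z) j) (\<lambda>j. Ej j z x t) n"
    by (simp add: conv_add_left conv_cmult_left)
  also have "\<dots> = conv (\<lambda>j. nuc z j + (if j = 0 then - of_real (S / 2) else 0)) (\<lambda>j. Ej j z x t) n"
    by (rule conv_cong) (use hc_nu[OF assms(3-5) _ assms(2)] assms(6) in auto)
  also have "\<dots> = conv (nuc z) (\<lambda>j. Ej j z x t) n - of_real (S / 2) * Ej n z x t"
    unfolding conv_add_left using le3_cases[OF assms(6)] by (elim disjE) (simp_all add: conv_simps)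
  finally have "of_real om * conv (hc w z) (\<lambda>j. Ej j z x t) n + conv (conv (hc w z) (nuc z)) (\<lambda>j. Ej j z x t) n
    = conv (nuc z) (\<lambda>j. Ej j z x t) n - of_real (S / 2) * Ej n z x t" .
  from arg_cong[OF this, of "\<lambda>e. \<i> * u x t * e"]
  show "u x t * (\<i> * conv (conv (hc w z) (nuc z)) (\<lambda>j. Ej j z x t) n)
      + \<i> * of_real om * u x t * conv (hc w z) (\<lambda>j. Ej j z x t) n
    = \<i> * u x t * (conv (nuc z) (\<lambda>j. Ej j z x t) n - of_real (S / 2) * Ej n z x t)"
    by (simp add: algebra_simps)
qed

definition T1 :: "nat \<Rightarrow> real \<Rightarrow> plane_fun" where
  "T1 n z x t = u10 x t * conv (hc k z) (\<lambda>j. Ej j z x t) n"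

definition T2 :: "nat \<Rightarrow> real \<Rightarrow> plane_fun" where
  "T2 n z x t = u20 x t * conv (hc (- k) z) (\<lambda>j. Ej j z x t) n"

lemma conv_G:
  assumes "n \<le> 3"
  shows "conv (\<lambda>j. of_real (G mu j z)) e n = of_real mu * (of_real z * e n + of_nat n * e (n - 1)) - 2 * e n
    + of_real (k * A) * conv (hc k z) e n - of_real (k * B) * conv (hc (- k) z) e n"
  using le3_cases[OF assms]
  by (elim disjE) (simp_all add: conv_simps G_def hc_def algebra_simps)

lemma conv_H:
  assumes "n \<le> 3"
  shows "conv (\<lambda>j. of_real (H mu j z)) e n = of_real (mu + S) * e n
    - of_real A * conv (hc k z) e n - of_real B * conv (hc (- k) z) e n - 2 * conv (nuc z) e n"
  using le3_cases[OF assms]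
  by (elim disjE) (simp_all add: conv_simps H_def hc_def nuc_def algebra_simps)

lemma u_T:
  "cnj (u10 x t) * T1 n z x t = of_real A * conv (hc k z) (\<lambda>j. Ej j z x t) n"
  "cnj (u20 x t) * T2 n z x t = of_real B * conv (hc (- k) z) (\<lambda>j. Ej j z x t) n"
  by (simp_all add: T1_def T2_def u10_sq u20_sq flip: mult.assoc)

lemma v_T:
  "cnj (v10 x t) * T1 n z x t = - \<i> * of_real (k * A) * conv (hc k z) (\<lambda>j. Ej j z x t) n"
  "cnj (v20 x t) * T2 n z x t = \<i> * of_real (k * B) * conv (hc (- k) z) (\<lambda>j. Ej j z x t) n"
  using u_T[of x t n z] by (simp_all add: v10_def v20_def mult.assoc)

text \<open>The Lax operators do not involve \<open>z\<close>, so the residual of the n-th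
  derivative of y is the n-th derivative of the residual, and Leibniz's rule turns it into a
  \<open>conv\<close>.\<close>

lemma lax_T:
  assumes "mu \<noteq> 0" "z \<noteq> 0" "k + z \<noteq> 0" "- k + z \<noteq> 0" "n \<le> 3"
  shows "lax (of_real mu) u10 v10 u20 v20 (Ej n z) (T1 n z) (T2 n z)
    (\<lambda>x t. \<i> / of_real mu * conv (\<lambda>j. of_real (G mu j z)) (\<lambda>j. Ej j z x t) n)
    (\<lambda>x t. - \<i> / 2 * conv (\<lambda>j. of_real (H mu j z)) (\<lambda>j. Ej j z x t) n)"
  unfolding lax_def has_pd_x_def has_pd_t_def u10_sq u20_sq u_T v_T conv_G[OF assms(5)] conv_H[OF assms(5)]
proof (intro conjI allI)
  fix x t
  let ?e = "\<lambda>j. Ej j z x t"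
  show "((\<lambda>\<xi>. Ej n z \<xi> t) has_vector_derivative
      2 * \<i> / of_real mu * Ej n z x t
      + (- \<i> * of_real (k * A) * conv (hc k z) ?e n + \<i> * of_real (k * B) * conv (hc (- k) z) ?e n) / of_real mu
      + \<i> / of_real mu * (of_real mu * (of_real z * Ej n z x t + of_nat n * Ej (n - 1) z x t) - 2 * Ej n z x t
        + of_real (k * A) * conv (hc k z) ?e n - of_real (k * B) * conv (hc (- k) z) ?e n)) (at x)"
    by (rule has_vector_derivative_eq_rhs, rule Ej_x[OF assms(5)])
      (use assms(1) in \<open>simp add: field_simps\<close>)
  show "((\<lambda>\<xi>. T1 n z \<xi> t) has_vector_derivative v10 x t * Ej n z x t) (at x)"
    unfolding T1_def v10_def by (rule component_x[where u = u10 and w = k, OF u10_x assms(3,5)])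
  show "((\<lambda>\<xi>. T2 n z \<xi> t) has_vector_derivative v20 x t * Ej n z x t) (at x)"
    unfolding T2_def v20_def using component_x[where u = u20 and w = "- k", OF _ assms(4,5)] u20_x by simp
  show "((\<lambda>\<tau>. Ej n z x \<tau>) has_vector_derivative
      \<i> * of_real mu / 2 * Ej n z x t
      - \<i> / 2 * (of_real A * conv (hc k z) ?e n + of_real B * conv (hc (- k) z) ?e n)
      + \<i> / 2 * (of_real A + of_real B) * Ej n z x t
      + - \<i> / 2 * (of_real (mu + S) * Ej n z x t - of_real A * conv (hc k z) ?e n
        - of_real B * conv (hc (- k) z) ?e n - 2 * conv (nuc z) ?e n)) (at t)"
    by (rule has_vector_derivative_eq_rhs, rule Ej_t[OF assms(5)]) (simp add: S_def field_simps)
  show "((\<lambda>\<tau>. T1 n z x \<tau>) has_vector_derivative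
      \<i> * of_real mu / 2 * u10 x t * Ej n z x t
      - \<i> / 2 * u10 x t * (of_real A * conv (hc k z) ?e n + of_real B * conv (hc (- k) z) ?e n)
      + u10 x t * (- \<i> / 2 * (of_real (mu + S) * Ej n z x t - of_real A * conv (hc k z) ?e n
        - of_real B * conv (hc (- k) z) ?e n - 2 * conv (nuc z) ?e n))) (at t)"
    unfolding T1_def
    by (rule has_vector_derivative_eq_rhs,
        rule component_t[where u = u10, OF u10_t omega(1) _ assms(3,2,5)])
      (use k_nz in \<open>simp_all add: field_simps\<close>)
  show "((\<lambda>\<tau>. T2 n z x \<tau>) has_vector_derivative
      \<i> * of_real mu / 2 * u20 x t * Ej n z x t
      - \<i> / 2 * u20 x t * (of_real A * conv (hc k z) ?e n + of_real B * conv (hc (- k) z) ?e n)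
      + u20 x t * (- \<i> / 2 * (of_real (mu + S) * Ej n z x t - of_real A * conv (hc k z) ?e n
        - of_real B * conv (hc (- k) z) ?e n - 2 * conv (nuc z) ?e n))) (at t)"
    unfolding T2_def
    by (rule has_vector_derivative_eq_rhs,
        rule component_t[where u = u20, OF u20_t omega(2) _ assms(4,2,5)])
      (use k_nz in \<open>simp_all add: field_simps\<close>)
qed

end

section \<open>The double root\<close>

locale FL_admissible = FL_background +
  assumes A_pos: "A > 0" and B_pos: "B > 0"
    and chi0_regular: "chi0 \<notin> {0, k, - k}"
    and Lam_deriv: "deriv Lam chi0 = 0"
    and Lam_deriv2: "deriv (deriv Lam) chi0 \<noteq> 0"
begin

lemma chi0_nz: "chi0 \<noteq> 0" "k + chi0 \<noteq> 0" "- k + chi0 \<noteq> 0"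
  using chi0_regular by auto

abbreviation "G0 \<equiv> G mu0"
abbreviation "H0 \<equiv> H mu0"

lemma G_deriv:
  assumes "k + z \<noteq> 0" "- k + z \<noteq> 0"
  shows "(G mu j has_real_derivative G mu (Suc j) z) (at z)"
proof -
  have "((\<lambda>z. (if j = 0 then mu * z - 2 else if j = 1 then mu else 0) + k * A * hj k j z - k * B * hj (- k) j z)
    has_real_derivative (if j = 0 then mu else 0) + k * A * hj k (Suc j) z - k * B * hj (- k) (Suc j) z) (at z)"
    using assms by (auto intro!: derivative_eq_intros hj_deriv)
  then show ?thesis by (auto simp: G_def[abs_def])
qed

lemma Lam_eq_G:
  assumes "z \<notin> {0, k, - k}"
  shows "Lam z = mu - G mu 0 z / z"
proof -
  have "hj k 0 z = k / (z + k)" "hj (- k) 0 z = - (k / (z - k))"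
    by (simp_all add: hj_def add.commute)
  then have "G mu 0 z = mu * z - (2 - k\<^sup>2 * (A / (z + k) + B / (z - k)))"
    by (simp add: G_def power2_eq_square algebra_simps)
  then show ?thesis
    using assms by (simp add: Lam_def diff_divide_distrib)
qed

lemma open_regular: "open (- {0, k, - k})"
  by (intro open_Compl finite_imp_closed) simp

lemma deriv_Lam_eq:
  assumes "z \<notin> {0, k, - k}"
  shows "deriv Lam z = - (G0 1 z * z - G0 0 z) / z\<^sup>2"
proof (rule DERIV_imp_deriv)
  have "k + z \<noteq> 0" "- k + z \<noteq> 0" "z \<noteq> 0" using assms by auto
  then have "((\<lambda>z. mu0 - G0 0 z / z) has_real_derivative - (G0 1 z * z - G0 0 z) / z\<^sup>2) (at z)"
    by (auto intro!: derivative_eq_intros G_deriv simp: power2_eq_square minus_divide_left)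
  then show "(Lam has_real_derivative - (G0 1 z * z - G0 0 z) / z\<^sup>2) (at z)"
    by (rule has_field_derivative_transform_within_open[OF _ open_regular])
      (use assms Lam_eq_G[where mu = mu0] in auto)
qed

lemma G0_0: "G0 0 chi0 = 0"
  using Lam_eq_G[of chi0 mu0] chi0_regular by (simp add: mu0_def)

lemma G0_1: "G0 1 chi0 = 0"
  using deriv_Lam_eq[OF chi0_regular] Lam_deriv G0_0 chi0_nz by simp

lemma G0_2: "G0 2 chi0 \<noteq> 0"
proof -
  have "((\<lambda>z. - (G0 1 z * z - G0 0 z) / z\<^sup>2) has_real_derivative - G0 2 chi0 / chi0) (at chi0)"
    using chi0_nz G0_0 G0_1
    by (auto intro!: derivative_eq_intros G_deriv simp: numeral_2_eq_2 power2_eq_square)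
  then have "(deriv Lam has_real_derivative - G0 2 chi0 / chi0) (at chi0)"
    by (rule has_field_derivative_transform_within_open[OF _ open_regular])
      (use chi0_regular deriv_Lam_eq in auto)
  then show ?thesis
    using Lam_deriv2 by (auto dest: DERIV_imp_deriv)
qed

text \<open>The condition G' = 0 at \<open>chi0\<close> expresses \<open>mu0\<close> as a sum of
  positive squares. The same identity says that Y_0 is isotropic for J, see
  \<open>null_00\<close>.\<close>

lemma mu0_pos: "mu0 > 0"
proof -
  have "mu0 = A * (k / (k + chi0))\<^sup>2 + B * (k / (- k + chi0))\<^sup>2"
    using G0_1 by (simp add: G_def hj_def power2_eq_square mult_ac)
  then show ?thesis
    using A_pos B_pos k_nz chi0_nz by (simp add: add_pos_pos)
qed

text \<open>Writing \<open>W = z\<^sup>2 - k\<^sup>2\<close>, the product \<open>G W\<close> is the cubic \<open>F\<close>; these are its derivatives.\<close>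

lemma G_cubic:
  assumes "k + z \<noteq> 0" "- k + z \<noteq> 0"
  shows "G mu 0 z * (z\<^sup>2 - k\<^sup>2) = mu * z ^ 3 - 2 * z\<^sup>2 + k\<^sup>2 * (S - mu) * z + k\<^sup>2 * (2 - k * R)"
    and "G mu 1 z * (z\<^sup>2 - k\<^sup>2) + 2 * z * G mu 0 z = 3 * mu * z\<^sup>2 - 4 * z + k\<^sup>2 * (S - mu)"
    and "G mu 2 z * (z\<^sup>2 - k\<^sup>2) + 4 * z * G mu 1 z + 2 * G mu 0 z = 6 * mu * z - 4"
    and "G mu 3 z * (z\<^sup>2 - k\<^sup>2) + 6 * z * G mu 2 z + 6 * G mu 1 z = 6 * mu"
proof -
  define a b where "a = 1 / (k + z)" and "b = 1 / (- k + z)"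
  have ab: "(k + z) * a = 1" "(- k + z) * b = 1" using assms by (auto simp: a_def b_def)
  have h: "hj k j z = (-1) ^ j * fact j * k * a ^ Suc j"
    "hj (- k) j z = (-1) ^ j * fact j * (- k) * b ^ Suc j" for j
    by (simp_all add: hj_def a_def b_def power_divide)
  show "G mu 0 z * (z\<^sup>2 - k\<^sup>2) = mu * z ^ 3 - 2 * z\<^sup>2 + k\<^sup>2 * (S - mu) * z + k\<^sup>2 * (2 - k * R)"
    using ab by (simp add: G_def h S_def R_def) algebra
  show "G mu 1 z * (z\<^sup>2 - k\<^sup>2) + 2 * z * G mu 0 z = 3 * mu * z\<^sup>2 - 4 * z + k\<^sup>2 * (S - mu)"
    using ab by (simp add: G_def h S_def R_def) algebra
  show "G mu 2 z * (z\<^sup>2 - k\<^sup>2) + 4 * z * G mu 1 z + 2 * G mu 0 z = 6 * mu * z - 4"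
    using ab by (simp add: G_def h fact_numeral) algebra
  show "G mu 3 z * (z\<^sup>2 - k\<^sup>2) + 6 * z * G mu 2 z + 6 * G mu 1 z = 6 * mu"
    using ab by (simp add: G_def h fact_numeral) algebra
qed

section \<open>Roots of the cubic and the identities satisfied by p1, s1 and kappas\<close>

lemma W0_nz: "chi0\<^sup>2 - k\<^sup>2 \<noteq> 0"
  using chi0_nz by (simp add: power2_eq_iff add_eq_0_iff2)

lemma chis_eq: "mu0 * chis = 2 - 2 * mu0 * chi0"
  using mu0_pos by (simp add: chis_def field_simps)

lemma mu0_L0: "mu0 * L0 = 3 * mu0 * chi0 - 2"
  using chis_eq by (simp add: L0_def algebra_simps)

lemma vieta1: "k\<^sup>2 * (S - mu0) = mu0 * (chi0\<^sup>2 + 2 * chi0 * chis)"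
  using G_cubic(2)[OF chi0_nz(2,3), of mu0] chis_eq G0_0 G0_1 by simp algebra

lemma vieta0: "k\<^sup>2 * (2 - k * R) = - (mu0 * chi0\<^sup>2 * chis)"
  using G_cubic(1)[OF chi0_nz(2,3), of mu0] chis_eq G0_0 vieta1 by simp algebra

lemma cubic_factor:
  "mu0 * z ^ 3 - 2 * z\<^sup>2 + k\<^sup>2 * (S - mu0) * z + k\<^sup>2 * (2 - k * R) = mu0 * (z - chi0)\<^sup>2 * (z - chis)"
  unfolding vieta1 vieta0 using chis_eq by algebra

lemma G0_2_eq: "G0 2 chi0 * (chi0\<^sup>2 - k\<^sup>2) = 2 * mu0 * L0"
  using G_cubic(3)[OF chi0_nz(2,3), of mu0] G0_0 G0_1 mu0_L0 by simp

lemma G0_3_eq: "G0 3 chi0 * (chi0\<^sup>2 - k\<^sup>2) = 6 * mu0 - 6 * chi0 * G0 2 chi0"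
  using G_cubic(4)[OF chi0_nz(2,3), of mu0] G0_1 by simp

lemma L0_nz: "L0 \<noteq> 0"
  using G0_2_eq G0_2 W0_nz mu0_pos by auto

text \<open>The cubic takes the nonzero values - 2 A k^3 at - k and 2 B k^3 at k, so its third root
  avoids both poles.\<close>

lemma chis_nz: "k + chis \<noteq> 0" "- k + chis \<noteq> 0"
proof -
  have "mu0 * (- k - chi0)\<^sup>2 * (- k - chis) = - (2 * A * k ^ 3)"
    unfolding cubic_factor[symmetric] S_def R_def by algebra
  then have "- k - chis \<noteq> 0"
    using A_pos k_nz by (metis mult_eq_0_iff neg_equal_0_iff_equal power_eq_0_iff less_irrefl zero_neq_numeral)
  then show "k + chis \<noteq> 0" by linarith
  have "mu0 * (k - chi0)\<^sup>2 * (k - chis) = 2 * B * k ^ 3"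
    unfolding cubic_factor[symmetric] S_def R_def by algebra
  then have "k - chis \<noteq> 0"
    using B_pos k_nz by (metis mult_eq_0_iff power_eq_0_iff less_irrefl zero_neq_numeral)
  then show "- k + chis \<noteq> 0" by linarith
qed

lemma Ws_nz: "chis\<^sup>2 - k\<^sup>2 \<noteq> 0"
  using chis_nz by (simp add: power2_eq_iff add_eq_0_iff2)

lemma G0_chis: "G0 0 chis = 0"
  using G_cubic(1)[OF chis_nz, of mu0] Ws_nz cubic_factor[of chis] by simp

lemma G0_1_chis: "G0 1 chis * (chis\<^sup>2 - k\<^sup>2) = mu0 * L0\<^sup>2"
proof -
  have "G0 1 chis * (chis\<^sup>2 - k\<^sup>2) = 3 * mu0 * chis\<^sup>2 - 4 * chis + mu0 * (chi0\<^sup>2 + 2 * chi0 * chis)"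
    using G_cubic(2)[OF chis_nz, of mu0] G0_chis by (simp add: vieta1)
  also have "\<dots> = mu0 * L0\<^sup>2"
    using chis_eq unfolding L0_def by algebra
  finally show ?thesis .
qed

lemma G_eq_H:
  assumes "z \<noteq> 0" "k + z \<noteq> 0" "- k + z \<noteq> 0"
  shows "G mu 0 z = z * H mu 0 z" "G mu 1 z = z * H mu 1 z + H mu 0 z"
    "G mu 2 z = z * H mu 2 z + 2 * H mu 1 z" "G mu 3 z = z * H mu 3 z + 3 * H mu 2 z"
proof -
  define a b c where "a = 1 / (k + z)" and "b = 1 / (- k + z)" and "c = 1 / z"
  have ab: "(k + z) * a = 1" "(- k + z) * b = 1" "z * c = 1"
    using assms by (auto simp: a_def b_def c_def)
  have h: "hj k j z = (-1) ^ j * fact j * k * a ^ Suc j"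
    "hj (- k) j z = (-1) ^ j * fact j * (- k) * b ^ Suc j"
    "2 * nuj j z = (if j = 0 then S else 0) + (-1) ^ j * fact j * (2 - k * R) * c ^ Suc j" for j
    by (simp_all add: hj_def a_def b_def c_def nuj_def power_divide)
  show "G mu 0 z = z * H mu 0 z"
    using ab by (simp add: G_def H_def h S_def R_def) algebra
  show "G mu 1 z = z * H mu 1 z + H mu 0 z"
    using ab by (simp add: G_def H_def h S_def R_def) algebra
  show "G mu 2 z = z * H mu 2 z + 2 * H mu 1 z"
    using ab by (simp add: G_def H_def h S_def R_def fact_numeral) algebra
  show "G mu 3 z = z * H mu 3 z + 3 * H mu 2 z"
    using ab by (simp add: G_def H_def h S_def R_def fact_numeral) algebra
qed

lemma H0_chi0: "H0 0 chi0 = 0" "H0 1 chi0 = 0"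
  using G_eq_H(1,2)[OF chi0_nz, of mu0] G0_0 G0_1 chi0_nz by simp_all

text \<open>To first order in eta = mu - mu0, at a split root with offset delta, G is eta chi0 + G''
  delta^2 / 2 with delta^2 = - p1 eta; it must vanish. For H the coefficient of eta is 1 instead of
  chi0, which gives \<open>p1_H\<close>.\<close>

lemma p1_G: "p1 * G0 2 chi0 = 2 * chi0"
proof -
  have "p1 * (G0 2 chi0 * (chi0\<^sup>2 - k\<^sup>2)) = 2 * chi0 * (chi0\<^sup>2 - k\<^sup>2)"
    using L0_nz mu0_pos unfolding G0_2_eq by (simp add: p1_def D0_def D_def)
  then show ?thesis using W0_nz by (simp flip: mult.assoc)
qed

lemma p1_H: "p1 * H0 2 chi0 = 2"
  using p1_G G_eq_H(3)[OF chi0_nz, of mu0] H0_chi0 chi0_nz by (simp add: mult.left_commute)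

text \<open>G vanishes at both split roots, hence so does its divided difference. To first order
  this is eta (1 + s1 G'' / 2 - p1 G''' / 6), where the 1 comes from the term mu z. In
  \<open>s1_H\<close> that term is the constant mu, whose divided difference is 0.\<close>

lemma s1_G: "s1 * G0 2 chi0 / 2 - p1 * G0 3 chi0 / 6 = - 1"
proof -
  define W where "W = chi0\<^sup>2 - k\<^sup>2"
  have W: "W \<noteq> 0" using W0_nz by (simp add: W_def)
  have "s1 * L0 * mu0 = p1 * mu0 - D1"
    using L0_nz mu0_pos by (simp add: s1_def field_simps)
  then have "s1 * (G0 2 chi0 * W) = 2 * (p1 * mu0 - D1)"
    using G0_2_eq by (simp add: W_def mult_ac)
  moreover have "p1 * (G0 3 chi0 * W) = 6 * mu0 * p1 - 6 * chi0 * (p1 * G0 2 chi0)"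
    unfolding W_def G0_3_eq by (simp add: algebra_simps)
  ultimately have "(s1 * G0 2 chi0 / 2 - p1 * G0 3 chi0 / 6) * W = 2 * chi0\<^sup>2 - D1"
    unfolding p1_G by (simp add: algebra_simps power2_eq_square)
  also have "\<dots> = - 1 * W"
    by (simp add: D1_def W_def)
  finally show ?thesis using W by (metis mult_right_cancel)
qed

lemma s1_H: "s1 * H0 2 chi0 / 2 - p1 * H0 3 chi0 / 6 = 0"
proof -
  have "chi0 * (s1 * H0 2 chi0 / 2 - p1 * H0 3 chi0 / 6) - p1 * H0 2 chi0 / 2 = - 1"
    using s1_G unfolding G_eq_H[OF chi0_nz] H0_chi0 by (simp add: algebra_simps)
  then show ?thesis unfolding p1_H using chi0_nz by simp
qed

text \<open>Implicit differentiation of G = 0 along the simple root, since the mu-derivative of G is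
  z.\<close>

lemma kappas_G: "kappas * G0 1 chis = - chis"
proof -
  have "G0 1 chis = mu0 * L0\<^sup>2 / (chis\<^sup>2 - k\<^sup>2)"
    using G0_1_chis Ws_nz by (simp add: field_simps)
  then show ?thesis
    using L0_nz mu0_pos Ws_nz by (simp add: kappas_def D_def)
qed

lemma H0_chis: "chis \<noteq> 0 \<Longrightarrow> H0 0 chis = 0"
  using G_eq_H(1)[OF _ chis_nz, of mu0] G0_chis by simp

lemma kappas_H:
  assumes "chis \<noteq> 0"
  shows "kappas * H0 1 chis = - 1"
proof -
  have "chis * (kappas * H0 1 chis) = chis * (- 1)"
    using kappas_G unfolding G_eq_H(2)[OF assms chis_nz] H0_chis[OF assms] by (simp add: mult.left_commute)
  then show ?thesis using assms by (metis mult_left_cancel)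
qed

text \<open>The \<open>J\<close>-products of the vectors at \<open>chi0\<close> and \<open>chis\<close>, up to phases. The mixed ones are
  divided differences of \<open>G\<close>, so they vanish at the double root together with a derivative.\<close>

lemma null_00: "mu0 - A * (hj k 0 chi0)\<^sup>2 - B * (hj (- k) 0 chi0)\<^sup>2 = 0"
  using G0_1 by (simp add: G_def hj_def power2_eq_square mult_ac)

lemma null_0s: "mu0 - A * hj k 0 chi0 * hj k 0 chis - B * hj (- k) 0 chi0 * hj (- k) 0 chis = 0"
proof -
  define a b c d where "a = 1 / (k + chi0)" and "b = 1 / (- k + chi0)"
    and "c = 1 / (k + chis)" and "d = 1 / (- k + chis)"
  have ab: "(k + chi0) * a = 1" "(- k + chi0) * b = 1" "(k + chis) * c = 1" "(- k + chis) * d = 1"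
    using chi0_nz chis_nz by (auto simp: a_def b_def c_def d_def)
  have h: "hj k 0 chi0 = k * a" "hj (- k) 0 chi0 = - k * b" "hj k 0 chis = k * c" "hj (- k) 0 chis = - k * d"
    by (simp_all add: hj_def a_def b_def c_def d_def)
  have "(chi0 - chis) * (mu0 - A * hj k 0 chi0 * hj k 0 chis - B * hj (- k) 0 chi0 * hj (- k) 0 chis)
    = G0 0 chi0 - G0 0 chis"
    unfolding G_def h using ab by simp algebra
  then show ?thesis using G0_0 G0_chis L0_nz by (simp add: L0_def)
qed

lemma null_1s: "A * hj k 1 chi0 * hj k 0 chis + B * hj (- k) 1 chi0 * hj (- k) 0 chis = 0"
proof -
  define a b c d where "a = 1 / (k + chi0)" and "b = 1 / (- k + chi0)"
    and "c = 1 / (k + chis)" and "d = 1 / (- k + chis)"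
  have ab: "(k + chi0) * a = 1" "(- k + chi0) * b = 1" "(k + chis) * c = 1" "(- k + chis) * d = 1"
    using chi0_nz chis_nz by (auto simp: a_def b_def c_def d_def)
  have h: "hj k 0 chi0 = k * a" "hj (- k) 0 chi0 = - k * b" "hj k 0 chis = k * c" "hj (- k) 0 chis = - k * d"
    "hj k 1 chi0 = - k * a\<^sup>2" "hj (- k) 1 chi0 = k * b\<^sup>2"
    by (simp_all add: hj_def a_def b_def c_def d_def power2_eq_square)
  have "(mu0 - A * hj k 0 chi0 * hj k 0 chis - B * hj (- k) 0 chi0 * hj (- k) 0 chis)
    - (chi0 - chis) * (A * hj k 1 chi0 * hj k 0 chis + B * hj (- k) 1 chi0 * hj (- k) 0 chis) = G0 1 chi0"
    unfolding G_def h using ab by simp algebra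
  then show ?thesis using G0_1 null_0s L0_nz by (simp add: L0_def)
qed

end

section \<open>The vectors \<open>y\<^sub>R\<close> and \<open>y\<^sub>\<mu>\<close>\<close>

lemma lax_cong:
  assumes "lax mu u1 v1 u2 v2 c p r f g"
    and "\<And>x t. f x t = f' x t" "\<And>x t. g x t = g' x t"
  shows "lax mu u1 v1 u2 v2 c p r f' g'"
proof -
  have "f = f'" "g = g'" using assms(2,3) by (simp_all add: fun_eq_iff)
  then show ?thesis using assms(1) by simp
qed

text \<open>The x-inhomogeneity required of y_mu is - 1 / mu times the right-hand side for the first
  component of y_R; uniqueness of derivatives allows it to be replaced by an explicit
  derivative.\<close>

lemma lax_x_rhs:
  assumes "lax mu u1 v1 u2 v2 c p r (\<lambda>x t. 0) (\<lambda>x t. 0)"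
    and "((\<lambda>\<xi>. c \<xi> t) has_vector_derivative c') (at x)"
  shows "2 * \<i> / mu * c x t + (cnj (v1 x t) * p x t + cnj (v2 x t) * r x t) / mu = c'"
  using vector_derivative_unique_at[OF _ assms(2)] assms(1)
  by (auto simp: lax_def has_pd_x_def)

lemma bra_ket_J: "bra_ket f J_mat g = cnj (f $ 1) * g $ 1 - cnj (f $ 2) * g $ 2 - cnj (f $ 3) * g $ 3"
  by (simp add: bra_ket_def J_mat_def matrix_vector_mult_def sum_3)

lemma bra_ket_K: "bra_ket f K_mat g = cnj (f $ 1) * g $ 1 + cnj (f $ 2) * g $ 2 + cnj (f $ 3) * g $ 3"
  by (simp add: bra_ket_def K_mat_def sum_3)

text \<open>The three hypotheses remove the products X-X, X-Z and Y-Z, so the simple branch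
  decouples from the double-root part.\<close>

lemma J_form_expansion:
  fixes m A B h1 h1' h1s h2 h2' h2s :: real and X Y Z :: complex
  assumes "m - A * h1\<^sup>2 - B * h2\<^sup>2 = 0" "m - A * h1 * h1s - B * h2 * h2s = 0"
    "A * h1' * h1s + B * h2' * h2s = 0"
  shows "m * ((X + Z) * cnj (X + Z))
      - A * ((h1 * X + h1' * Y + h1s * Z) * cnj (h1 * X + h1' * Y + h1s * Z))
      - B * ((h2 * X + h2' * Y + h2s * Z) * cnj (h2 * X + h2' * Y + h2s * Z))
    = - of_real (A * h1'\<^sup>2 + B * h2'\<^sup>2) * (Y * cnj Y) - of_real (A * h1 * h1' + B * h2 * h2') * (X * cnj Y + Y * cnj X)
      + of_real (m - A * h1s\<^sup>2 - B * h2s\<^sup>2) * (Z * cnj Z)"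
proof -
  have "m * ((X + Z) * cnj (X + Z))
      - A * ((h1 * X + h1' * Y + h1s * Z) * cnj (h1 * X + h1' * Y + h1s * Z))
      - B * ((h2 * X + h2' * Y + h2s * Z) * cnj (h2 * X + h2' * Y + h2s * Z))
    = of_real (m - A * h1\<^sup>2 - B * h2\<^sup>2) * (X * cnj X)
      + of_real (m - A * h1 * h1s - B * h2 * h2s) * (X * cnj Z + Z * cnj X)
      - of_real (A * h1' * h1s + B * h2' * h2s) * (Y * cnj Z + Z * cnj Y)
      + (- of_real (A * h1'\<^sup>2 + B * h2'\<^sup>2) * (Y * cnj Y)
        - of_real (A * h1 * h1' + B * h2 * h2') * (X * cnj Y + Y * cnj X)
        + of_real (m - A * h1s\<^sup>2 - B * h2s\<^sup>2) * (Z * cnj Z))"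
    by (simp add: algebra_simps power2_eq_square)
  then show ?thesis unfolding assms by simp
qed

section \<open>The simple branch, including its degenerate case chis = 0\<close>

context FL_admissible
begin

text \<open>If chis = 0, then \<open>vieta0\<close> forces k R = 2, so 0 is a root of the cubic for
  every mu. There \<open>nu\<close> has no meaningful value; mu / 2 is the one for which A h1 + B h2
  - S + 2 nu equals mu, as h1 = h2 = 1 at 0.\<close>

definition nus :: real where "nus = (if chis \<noteq> 0 then nu chis else mu0 / 2)"

definition Es :: plane_fun where "Es x t = exp (\<i> * of_real (chis * x + nus * t))"

lemma Es_eq_E: "chis \<noteq> 0 \<Longrightarrow> Es = E chis"
  by (auto simp: fun_eq_iff Es_def nus_def E_def)

lemma hj_0: "hj k 0 0 = 1" "hj (- k) 0 0 = 1"
  using k_nz by (simp_all add: hj_def)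

lemma hj_chis_0: "chis = 0 \<Longrightarrow> hj k 0 chis = 1" "chis = 0 \<Longrightarrow> hj (- k) 0 chis = 1"
  by (simp_all add: hj_0)

lemma conv_G_chi0:
  "conv (\<lambda>j. of_real (G0 j chi0)) e 0 = 0"
  "conv (\<lambda>j. of_real (G0 j chi0)) e (Suc 0) = 0"
  "conv (\<lambda>j. of_real (G0 j chi0)) e 2 = of_real (G0 2 chi0) * e 0"
  "conv (\<lambda>j. of_real (G0 j chi0)) e 3 = 3 * of_real (G0 2 chi0) * e 1 + of_real (G0 3 chi0) * e 0"
  using G0_0 G0_1 by (simp_all add: conv_simps)

lemma conv_H_chi0:
  "conv (\<lambda>j. of_real (H0 j chi0)) e 0 = 0"
  "conv (\<lambda>j. of_real (H0 j chi0)) e (Suc 0) = 0"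
  "conv (\<lambda>j. of_real (H0 j chi0)) e 2 = of_real (H0 2 chi0) * e 0"
  "conv (\<lambda>j. of_real (H0 j chi0)) e 3 = 3 * of_real (H0 2 chi0) * e 1 + of_real (H0 3 chi0) * e 0"
  using H0_chi0 by (simp_all add: conv_simps)

abbreviation "lax0 \<equiv> lax (of_real mu0) u10 v10 u20 v20"

lemmas lax_chi0 = lax_T[OF less_imp_neq[OF mu0_pos, symmetric] chi0_nz]
lemmas lax_chis = lax_T[OF less_imp_neq[OF mu0_pos, symmetric] _ chis_nz]

lemma T_0: "T1 0 z x t = u10 x t * of_real (hj k 0 z) * E z x t"
  "T2 0 z x t = u20 x t * of_real (hj (- k) 0 z) * E z x t"
  by (simp_all add: T1_def T2_def conv_simps Ej_simps hc_def)

lemma T_1: "T1 (Suc 0) z x t = u10 x t * (hj k 0 z * Ej 1 z x t + hj k 1 z * E z x t)"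
  "T2 (Suc 0) z x t = u20 x t * (hj (- k) 0 z * Ej 1 z x t + hj (- k) 1 z * E z x t)"
  by (simp_all add: T1_def T2_def conv_simps Ej_simps hc_def)

definition Ps :: plane_fun where "Ps x t = u10 x t * of_real (hj k 0 chis) * Es x t"
definition Rs :: plane_fun where "Rs x t = u20 x t * of_real (hj (- k) 0 chis) * Es x t"

lemma chis_0_omega:
  assumes "chis = 0"
  shows "k * R = 2" "omega1 = - S / 2" "omega2 = - S / 2"
proof -
  show "k * R = 2" using vieta0 assms k_nz by simp
  then show "omega1 = - S / 2" "omega2 = - S / 2" by (simp_all add: omega)
qed

lemma Es_x: "((\<lambda>\<xi>. Es \<xi> t) has_vector_derivative \<i> * of_real chis * Es x t) (at x)"
  unfolding Es_def by (auto intro!: derivative_eq_intros)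

lemma Es_t: "((\<lambda>\<tau>. Es x \<tau>) has_vector_derivative \<i> * of_real nus * Es x t) (at t)"
  unfolding Es_def by (auto intro!: derivative_eq_intros)

lemma chis_0_products:
  assumes "chis = 0"
  shows "cnj (u10 x t) * Ps x t = of_real A * Es x t" "cnj (u20 x t) * Rs x t = of_real B * Es x t"
    "cnj (v10 x t) * Ps x t = - \<i> * of_real (k * A) * Es x t"
    "cnj (v20 x t) * Rs x t = \<i> * of_real (k * B) * Es x t"
  using u10_sq[of x t] u20_sq[of x t] assms
  by (simp_all add: Ps_def Rs_def hj_0 v10_def v20_def mult_ac)

lemma lax_Es: "lax0 Es Ps Rs (\<lambda>x t. 0) (\<lambda>x t. 0)"
proof (cases "chis = 0")
  case False
  have "lax0 (Ej 0 chis) (T1 0 chis) (T2 0 chis) (\<lambda>x t. 0) (\<lambda>x t. 0)"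
    by (rule lax_cong[OF lax_chis[OF False]])
      (use G0_chis H0_chis[OF False] in \<open>simp_all add: conv_simps\<close>)
  moreover have "Ej 0 chis = Es" "T1 0 chis = Ps" "T2 0 chis = Rs"
    using False by (auto simp: fun_eq_iff Ej_simps T_0 Ps_def Rs_def Es_eq_E)
  ultimately show ?thesis by simp
next
  case True
  have kAB: "complex_of_real k * of_real A = 2 + of_real k * of_real B"
    using arg_cong[OF chis_0_omega(1)[OF True], of complex_of_real] by (simp add: R_def algebra_simps)
  show ?thesis
    unfolding lax_def has_pd_x_def has_pd_t_def u10_sq u20_sq chis_0_products[OF True]
  proof (intro conjI allI)
    fix x t
    show "((\<lambda>\<xi>. Es \<xi> t) has_vector_derivative 2 * \<i> / of_real mu0 * Es x t
      + (- \<i> * of_real (k * A) * Es x t + \<i> * of_real (k * B) * Es x t) / of_real mu0 + 0) (at x)"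
      by (rule has_vector_derivative_eq_rhs, rule Es_x)
        (use True kAB in \<open>simp add: algebra_simps flip: add_divide_distrib diff_divide_distrib\<close>)
    show "((\<lambda>\<xi>. Ps \<xi> t) has_vector_derivative v10 x t * Es x t) (at x)"
      unfolding Ps_def hj_chis_0[OF True]
      by (rule has_vector_derivative_eq_rhs, (rule derivative_intros u10_x Es_x)+)
        (simp add: True v10_def)
    show "((\<lambda>\<xi>. Rs \<xi> t) has_vector_derivative v20 x t * Es x t) (at x)"
      unfolding Rs_def hj_chis_0[OF True]
      by (rule has_vector_derivative_eq_rhs, (rule derivative_intros u20_x Es_x)+)
        (simp add: True v20_def)
    show "((\<lambda>\<tau>. Es x \<tau>) has_vector_derivative \<i> * of_real mu0 / 2 * Es x t
      - \<i> / 2 * (of_real A * Es x t + of_real B * Es x t)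
      + \<i> / 2 * (of_real A + of_real B) * Es x t + 0) (at t)"
      by (rule has_vector_derivative_eq_rhs, rule Es_t) (simp add: True nus_def algebra_simps)
    show "((\<lambda>\<tau>. Ps x \<tau>) has_vector_derivative \<i> * of_real mu0 / 2 * u10 x t * Es x t
      - \<i> / 2 * u10 x t * (of_real A * Es x t + of_real B * Es x t) + u10 x t * 0) (at t)"
      unfolding Ps_def hj_chis_0[OF True]
      by (rule has_vector_derivative_eq_rhs, (rule derivative_intros u10_t Es_t)+)
        (simp add: True nus_def chis_0_omega S_def field_simps)
    show "((\<lambda>\<tau>. Rs x \<tau>) has_vector_derivative \<i> * of_real mu0 / 2 * u20 x t * Es x t
      - \<i> / 2 * u20 x t * (of_real A * Es x t + of_real B * Es x t) + u20 x t * 0) (at t)"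
      unfolding Rs_def hj_chis_0[OF True]
      by (rule has_vector_derivative_eq_rhs, (rule derivative_intros u20_t Es_t)+)
        (simp add: True nus_def chis_0_omega S_def field_simps)
  qed
qed

definition dS :: plane_fun where
  "dS x t = (if chis \<noteq> 0 then of_real kappas * Ej 1 chis x t else \<i> * of_real t / 2 * Es x t)"
definition pS :: plane_fun where
  "pS x t = (if chis \<noteq> 0 then of_real kappas * T1 1 chis x t else \<i> * of_real t / 2 * Ps x t)"
definition rS :: plane_fun where
  "rS x t = (if chis \<noteq> 0 then of_real kappas * T2 1 chis x t else \<i> * of_real t / 2 * Rs x t)"

text \<open>In the degenerate case the root stays at 0 as mu varies, and only the phase mu t / 2 is
  differentiated. The factor i t / 2 adds to the t-derivative a multiple of (1, u1, u2), which is
  the shape of a t-inhomogeneity.\<close>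

lemma lax_ramp:
  assumes "lax mu u1 v1 u2 v2 c p r (\<lambda>x t. 0) (\<lambda>x t. 0)"
    and "\<And>x t. p x t = u1 x t * c x t" "\<And>x t. r x t = u2 x t * c x t"
  shows "lax mu u1 v1 u2 v2 (\<lambda>x t. \<i> * of_real t / 2 * c x t) (\<lambda>x t. \<i> * of_real t / 2 * p x t)
    (\<lambda>x t. \<i> * of_real t / 2 * r x t) (\<lambda>x t. 0) (\<lambda>x t. \<i> / 2 * c x t)"
proof -
  have *: "((\<lambda>\<tau>. \<i> * of_real \<tau> / 2 * w \<tau>) has_vector_derivative \<i> * of_real t / 2 * w' + \<i> / 2 * w t) (at t)"
    if "(w has_vector_derivative w') (at t)" for w w' t
    by (rule has_vector_derivative_eq_rhs, rule has_vector_derivative_mult[OF _ that],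
        (rule derivative_intros DERIV_ident)+) simp
  note [simp] = assms(2,3)
  from assms(1) show ?thesis
    unfolding lax_def has_pd_x_def has_pd_t_def
    by (elim conjE, intro conjI allI)
      ((rule has_vector_derivative_eq_rhs, rule has_vector_derivative_mult_right, blast, simp add: algebra_simps add_divide_distrib; fail) |
       (rule has_vector_derivative_eq_rhs, rule *, blast, simp add: algebra_simps add_divide_distrib; fail))+
qed

lemma lax_dS: "lax0 dS pS rS (\<lambda>x t. - (\<i> * of_real chis * Es x t) / of_real mu0) (\<lambda>x t. \<i> / 2 * Es x t)"
proof (cases "chis = 0")
  case False
  have G: "of_real kappas * complex_of_real (G0 1 chis) = - of_real chis"
    using arg_cong[OF kappas_G, of complex_of_real] by simp
  have H: "of_real kappas * complex_of_real (H0 1 chis) = - 1"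
    using arg_cong[OF kappas_H[OF False], of complex_of_real] by simp
  have "lax0 (\<lambda>x t. of_real kappas * Ej (Suc 0) chis x t) (\<lambda>x t. of_real kappas * T1 (Suc 0) chis x t)
    (\<lambda>x t. of_real kappas * T2 (Suc 0) chis x t)
    (\<lambda>x t. - (\<i> * of_real chis * Es x t) / of_real mu0) (\<lambda>x t. \<i> / 2 * Es x t)"
  proof (rule lax_cong[OF lax_cmult[OF lax_chis[OF False]]])
    fix x t
    have "of_real kappas * (\<i> / of_real mu0 * conv (\<lambda>j. of_real (G0 j chis)) (\<lambda>j. Ej j chis x t) (Suc 0))
      = \<i> / of_real mu0 * (of_real kappas * of_real (G0 1 chis)) * Es x t"
      using G0_chis by (simp add: conv_simps Es_eq_E[OF False] Ej_simps)
    then show "of_real kappas * (\<i> / of_real mu0 * conv (\<lambda>j. of_real (G0 j chis)) (\<lambda>j. Ej j chis x t) (Suc 0))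
      = - (\<i> * of_real chis * Es x t) / of_real mu0"
      unfolding G by simp
    have "of_real kappas * (- \<i> / 2 * conv (\<lambda>j. of_real (H0 j chis)) (\<lambda>j. Ej j chis x t) (Suc 0))
      = - \<i> / 2 * (of_real kappas * of_real (H0 1 chis)) * Es x t"
      using H0_chis[OF False] by (simp add: conv_simps Es_eq_E[OF False] Ej_simps)
    then show "of_real kappas * (- \<i> / 2 * conv (\<lambda>j. of_real (H0 j chis)) (\<lambda>j. Ej j chis x t) (Suc 0))
      = \<i> / 2 * Es x t"
      unfolding H by simp
  qed simp
  then show ?thesis using False by (simp add: dS_def[abs_def] pS_def[abs_def] rS_def[abs_def])
next
  case True
  show ?thesis
    using lax_ramp[OF lax_Es] True
    by (simp add: dS_def[abs_def] pS_def[abs_def] rS_def[abs_def] Ps_def Rs_def hj_0)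
qed

section \<open>Lax equations for yR and ymu\<close>

definition cR :: plane_fun where
  "cR x t = Ej 0 chi0 x t + M1 * Ej (Suc 0) chi0 x t + cs * Es x t"
definition pR :: plane_fun where
  "pR x t = T1 0 chi0 x t + M1 * T1 (Suc 0) chi0 x t + cs * Ps x t"
definition rR :: plane_fun where
  "rR x t = T2 0 chi0 x t + M1 * T2 (Suc 0) chi0 x t + cs * Rs x t"

definition al :: complex where "al = (of_real s1 * M1 - of_real p1) / 2"
definition be :: complex where "be = - (of_real p1 * M1 / 6)"

definition dR :: plane_fun where
  "dR x t = al * Ej 2 chi0 x t + be * Ej 3 chi0 x t + cs * dS x t"
definition pM :: plane_fun where
  "pM x t = al * T1 2 chi0 x t + be * T1 3 chi0 x t + cs * pS x t"
definition rM :: plane_fun where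
  "rM x t = al * T2 2 chi0 x t + be * T2 3 chi0 x t + cs * rS x t"

lemma lax_R: "lax0 cR pR rR (\<lambda>x t. 0) (\<lambda>x t. 0)"
proof -
  have "lax0 (Ej n chi0) (T1 n chi0) (T2 n chi0) (\<lambda>x t. 0) (\<lambda>x t. 0)" if "n = 0 \<or> n = Suc 0" for n
    by (rule lax_cong[OF lax_chi0]) (use that in \<open>auto simp: conv_G_chi0 conv_H_chi0\<close>)
  note L = this[of 0, OF disjI1, OF refl] this[of "Suc 0", OF disjI2, OF refl]
  show ?thesis unfolding cR_def[abs_def] pR_def[abs_def] rR_def[abs_def]
    by (rule lax_cong[OF lax_add[OF lax_add[OF L(1) lax_cmult[OF L(2)]] lax_cmult[OF lax_Es]]]) simp_all
qed

lemma cR_x: "((\<lambda>\<xi>. cR \<xi> t) has_vector_derivative \<i> * (of_real chi0 * E chi0 x t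
    + M1 * (of_real chi0 * Ej 1 chi0 x t + E chi0 x t) + cs * of_real chis * Es x t)) (at x)"
  unfolding cR_def
  by (rule has_vector_derivative_eq_rhs,
      (rule derivative_intros Es_x Ej_x[of 0, simplified] Ej_x[of "Suc 0", simplified])+)
    (simp add: Ej_simps algebra_simps)

lemma lax_M: "lax0 dR pM rM
  (\<lambda>x t. - (2 * \<i> / of_real mu0 * cR x t
    + (cnj (v10 x t) * pR x t + cnj (v20 x t) * rR x t) / of_real mu0) / of_real mu0)
  (\<lambda>x t. \<i> / 2 * cR x t)"
proof -
  have L2: "lax0 (Ej 2 chi0) (T1 2 chi0) (T2 2 chi0)
      (\<lambda>x t. \<i> / of_real mu0 * (of_real (G0 2 chi0) * E chi0 x t))
      (\<lambda>x t. - \<i> / 2 * (of_real (H0 2 chi0) * E chi0 x t))"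
    by (rule lax_cong[OF lax_chi0]) (simp_all add: conv_G_chi0 conv_H_chi0 Ej_simps)
  have L3: "lax0 (Ej 3 chi0) (T1 3 chi0) (T2 3 chi0)
      (\<lambda>x t. \<i> / of_real mu0 * (3 * of_real (G0 2 chi0) * Ej 1 chi0 x t + of_real (G0 3 chi0) * E chi0 x t))
      (\<lambda>x t. - \<i> / 2 * (3 * of_real (H0 2 chi0) * Ej 1 chi0 x t + of_real (H0 3 chi0) * E chi0 x t))"
    by (rule lax_cong[OF lax_chi0]) (simp_all add: conv_G_chi0 conv_H_chi0 Ej_simps)
  have G: "complex_of_real p1 * of_real (G0 2 chi0) = 2 * of_real chi0"
    "complex_of_real s1 * of_real (G0 2 chi0) / 2 - of_real p1 * of_real (G0 3 chi0) / 6 = - 1"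
    using arg_cong[OF p1_G, of complex_of_real] arg_cong[OF s1_G, of complex_of_real] by simp_all
  have H: "complex_of_real p1 * of_real (H0 2 chi0) = 2"
    "complex_of_real s1 * of_real (H0 2 chi0) / 2 - of_real p1 * of_real (H0 3 chi0) / 6 = 0"
    using arg_cong[OF p1_H, of complex_of_real] arg_cong[OF s1_H, of complex_of_real] by simp_all
  \<comment> \<open>The residuals of orders 2 and 3 are regrouped so that s1 and p1 enter only
    through the combinations evaluated in \<open>G\<close> and \<open>H\<close>; \<open>w\<close> is
    the common prefactor, i / mu0 or - i / 2.\<close>
  have comb: "al * (w * (of_real g2 * e0)) + be * (w * (3 * of_real g2 * e1 + of_real g3 * e0))
    = w * (M1 * (of_real s1 * of_real g2 / 2 - of_real p1 * of_real g3 / 6) * e0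
      - (of_real p1 * of_real g2) / 2 * e0 - M1 * (of_real p1 * of_real g2) / 2 * e1)" for w e0 e1 g2 g3
    by (simp add: al_def be_def field_simps)
  show ?thesis
    unfolding lax_x_rhs[OF lax_R cR_x] unfolding dR_def[abs_def] pM_def[abs_def] rM_def[abs_def]
  proof (rule lax_cong[OF lax_add[OF lax_add[OF lax_cmult[OF L2] lax_cmult[OF L3]] lax_cmult[OF lax_dS]]])
    fix x t
    show "al * (\<i> / of_real mu0 * (of_real (G0 2 chi0) * E chi0 x t))
        + be * (\<i> / of_real mu0 * (3 * of_real (G0 2 chi0) * Ej 1 chi0 x t + of_real (G0 3 chi0) * E chi0 x t))
        + cs * (- (\<i> * of_real chis * Es x t) / of_real mu0)
      = - (\<i> * (of_real chi0 * E chi0 x t + M1 * (of_real chi0 * Ej 1 chi0 x t + E chi0 x t)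
          + cs * of_real chis * Es x t)) / of_real mu0"
      unfolding comb G by (simp add: algebra_simps diff_divide_distrib add_divide_distrib)
    show "al * (- \<i> / 2 * (of_real (H0 2 chi0) * E chi0 x t))
        + be * (- \<i> / 2 * (3 * of_real (H0 2 chi0) * Ej 1 chi0 x t + of_real (H0 3 chi0) * E chi0 x t))
        + cs * (\<i> / 2 * Es x t) = \<i> / 2 * cR x t"
      unfolding comb H by (simp add: cR_def Ej_simps algebra_simps)
  qed
qed

lemma lam0_sq: "lam0\<^sup>2 = mu0" and lam0_pos: "lam0 > 0"
  using mu0_pos by (simp_all add: lam0_def)

lemma Ys_eq: "Ys x t = vector [of_real lam0 * Es x t, Ps x t, Rs x t]"
proof (cases "chis = 0")
  case True
  then show ?thesis
    by (simp add: Ys_def Es_def nus_def Ps_def Rs_def hj_0 vec_eq_iff forall_3 algebra_simps)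
next
  case False
  then show ?thesis
    by (simp add: Ys_def y_eq_yj yj_def Es_eq_E Ps_def Rs_def conv_simps Ej_simps hc_def mult.assoc)
qed

lemma Y_eq: "n \<le> 3 \<Longrightarrow> Y n x t = vector [of_real lam0 * Ej n chi0 x t, T1 n chi0 x t, T2 n chi0 x t]"
  by (simp add: Y_def nth_deriv_y[OF chi0_nz] yj_def T1_def T2_def)

lemma Ysmu_eq: "Ysmu x t = vector [Es x t / (2 * of_real lam0) + of_real lam0 * dS x t, pS x t, rS x t]"
proof (cases "chis = 0")
  case True
  then show ?thesis
    by (simp add: Ysmu_def dS_def pS_def rS_def Es_def nus_def Ps_def Rs_def hj_0 vec_eq_iff
        forall_3 algebra_simps)
next
  case False
  have "nth_deriv 1 (\<lambda>z. y z lam0 x t) chis = yj 1 chis x t"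
    using nth_deriv_y[OF False chis_nz] by simp
  then show ?thesis using False
    by (simp add: Ysmu_def dS_def pS_def rS_def Es_eq_E yj_def T1_def T2_def vec_eq_iff forall_3)
qed

lemma yR_eq: "yR x t = vector [of_real lam0 * cR x t, pR x t, rR x t]"
  by (simp add: yR_def Y_eq Ys_eq cR_def pR_def rR_def vec_eq_iff forall_3 algebra_simps)

lemma En_eq: "n \<le> 3 \<Longrightarrow> En n x t = Ej n chi0 x t"
  by (simp add: En_def nth_deriv_E chi0_nz)

lemma ymu_eq: "ymu x t = vector [cR x t / (2 * of_real lam0) + of_real lam0 * dR x t, pM x t, rM x t]"
  using lam0_pos
  by (simp add: ymu_def Y_eq Ysmu_eq En_eq cR_def dR_def pM_def rM_def al_def be_def vec_eq_iff forall_3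
      field_simps)

end

section \<open>Smoothness, isotropy and linear independence\<close>

context FL_admissible
begin

lemma smooth_u10: "globally_smooth u10" and smooth_u20: "globally_smooth u20"
  unfolding u10_def[abs_def] u20_def[abs_def] by (intro globally_smooth_intros)+

lemma smooth_E: "globally_smooth (E z)"
  unfolding E_def[abs_def] by (intro globally_smooth_intros)

lemma smooth_Es: "globally_smooth Es"
  unfolding Es_def[abs_def] by (intro globally_smooth_intros)

lemma smooth_th: "globally_smooth (th j z)"
  unfolding th_def[abs_def] by (intro globally_smooth_intros)

lemma smooth_Ej: "n \<le> 3 \<Longrightarrow> globally_smooth (Ej n z)"
proof -
  have "globally_smooth (\<lambda>x t. Ej n z x t)" if "n = 0 \<or> n = Suc 0 \<or> n = 2 \<or> n = 3" for n
    using that by (elim disjE; simp only: Ej_simps power2_eq_square power3_eq_cube)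
      (intro globally_smooth_intros smooth_E smooth_th)+
  then show "n \<le> 3 \<Longrightarrow> globally_smooth (Ej n z)" using le3_cases by blast
qed

lemma smooth_T:
  assumes "n \<le> 3"
  shows "globally_smooth (T1 n z)" "globally_smooth (T2 n z)"
proof -
  have "globally_smooth (\<lambda>x t. conv h (\<lambda>j. Ej j z x t) n)" for h
    using le3_cases[OF assms]
    by (elim disjE; simp only: conv_simps) (intro globally_smooth_intros smooth_Ej; simp)+
  then show "globally_smooth (T1 n z)" "globally_smooth (T2 n z)"
    unfolding T1_def[abs_def] T2_def[abs_def]
    by (intro globally_smooth_intros smooth_u10 smooth_u20; simp)+
qed

lemma smooth_Ps: "globally_smooth Ps" and smooth_Rs: "globally_smooth Rs"
  unfolding Ps_def[abs_def] Rs_def[abs_def]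
  by (intro globally_smooth_intros smooth_u10 smooth_u20 smooth_Es)+

lemma smooth_t: "globally_smooth (\<lambda>x t. of_real t)"
  using globally_smooth_of_real_affine[of 0 1] by simp

lemma smooth_S: "globally_smooth dS" "globally_smooth pS" "globally_smooth rS"
proof -
  have "globally_smooth (\<lambda>x t. \<i> * of_real t / 2 * w x t)" if "globally_smooth w" for w
    by (intro globally_smooth_intros smooth_t that) simp
  moreover have "globally_smooth (\<lambda>x t. of_real kappas * w x t)" if "globally_smooth w" for w
    by (intro globally_smooth_intros that)
  ultimately show "globally_smooth dS" "globally_smooth pS" "globally_smooth rS"
    unfolding dS_def[abs_def] pS_def[abs_def] rS_def[abs_def]
    using smooth_Ej[of 1 chis] smooth_T[of 1 chis] smooth_Es smooth_Ps smooth_Rs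
    by (cases "chis = 0"; simp)+
qed

lemma smooth_R: "globally_smooth cR" "globally_smooth pR" "globally_smooth rR"
  unfolding cR_def[abs_def] pR_def[abs_def] rR_def[abs_def]
  by (intro globally_smooth_intros smooth_Ej smooth_T smooth_Es smooth_Ps smooth_Rs; simp)+

lemma smooth_M: "globally_smooth dR" "globally_smooth pM" "globally_smooth rM"
  unfolding dR_def[abs_def] pM_def[abs_def] rM_def[abs_def]
  by (intro globally_smooth_intros smooth_Ej smooth_T smooth_S; simp)+

section \<open>Values of the J-form on Y_0, Y_1, Y_s and yR\<close>

lemma cnj_th: "cnj (th j z x t) = - th j z x t"
  by (simp add: th_def)

lemma cnj_E_E: "cnj (E z x t) * E z x t = 1" "cnj (Es x t) * Es x t = 1"
  by (simp_all add: E_def Es_def exp_cnj flip: exp_add)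

definition aa :: real where "aa = A * hj k 0 chi0 * hj k 1 chi0 + B * hj (- k) 0 chi0 * hj (- k) 1 chi0"
definition bb :: real where "bb = A * (hj k 1 chi0)\<^sup>2 + B * (hj (- k) 1 chi0)\<^sup>2"
definition dd :: real where "dd = mu0 - A * (hj k 0 chis)\<^sup>2 - B * (hj (- k) 0 chis)\<^sup>2"

lemma J_form_background:
  "of_real mu0 * (c * cnj c) - (u10 x t * p) * cnj (u10 x t * p) - (u20 x t * r) * cnj (u20 x t * r)
    = of_real mu0 * (c * cnj c) - of_real A * (p * cnj p) - of_real B * (r * cnj r)"
proof -
  have e: "(u10 x t * p) * cnj (u10 x t * p) = (cnj (u10 x t) * u10 x t) * (p * cnj p)"
    "(u20 x t * r) * cnj (u20 x t * r) = (cnj (u20 x t) * u20 x t) * (r * cnj r)"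
    by (simp_all add: mult_ac)
  show ?thesis by (simp only: e[unfolded u10_sq u20_sq])
qed

text \<open>The components in terms of the coefficients \<open>X\<close>, \<open>Y\<close>, \<open>Z\<close> of the three vectors
  \<open>(1, h\<^sub>1, h\<^sub>2)\<close>, \<open>(0, h\<^sub>1', h\<^sub>2')\<close> at \<open>chi0\<close> and \<open>(1, h\<^sub>1, h\<^sub>2)\<close> at \<open>chis\<close>.\<close>

definition XX :: plane_fun where "XX x t = (1 + M1 * th 1 chi0 x t) * E chi0 x t"
definition YY :: plane_fun where "YY x t = M1 * E chi0 x t"
definition ZZ :: plane_fun where "ZZ x t = cs * Es x t"

lemma R_XYZ:
  "cR x t = XX x t + ZZ x t"
  "pR x t = u10 x t * (hj k 0 chi0 * XX x t + hj k 1 chi0 * YY x t + hj k 0 chis * ZZ x t)"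
  "rR x t = u20 x t * (hj (- k) 0 chi0 * XX x t + hj (- k) 1 chi0 * YY x t + hj (- k) 0 chis * ZZ x t)"
  by (simp_all add: cR_def pR_def rR_def XX_def YY_def ZZ_def T_0 T_1 Ps_def Rs_def Ej_simps algebra_simps)

text \<open>The phases have modulus one and \<open>th 1\<close> is imaginary. So in the X-Y product
  the terms linear in x and t, which carry |M1|^2, cancel and leave 2 Re M1.\<close>

lemma J_form_R:
  "of_real mu0 * (cR x t * cnj (cR x t)) - pR x t * cnj (pR x t) - rR x t * cnj (rR x t)
    = - of_real bb * of_real ((cmod M1)\<^sup>2) - 2 * of_real aa * of_real (Re M1) + of_real dd * of_real ((cmod cs)\<^sup>2)"
proof -
  have "YY x t * cnj (YY x t) = (M1 * cnj M1) * (cnj (E chi0 x t) * E chi0 x t)"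
    "ZZ x t * cnj (ZZ x t) = (cs * cnj cs) * (cnj (Es x t) * Es x t)"
    "XX x t * cnj (YY x t) + YY x t * cnj (XX x t) = (M1 + cnj M1) * (cnj (E chi0 x t) * E chi0 x t)"
    by (simp_all add: XX_def YY_def ZZ_def cnj_th algebra_simps)
  then have *: "YY x t * cnj (YY x t) = of_real ((cmod M1)\<^sup>2)"
    "ZZ x t * cnj (ZZ x t) = of_real ((cmod cs)\<^sup>2)"
    "XX x t * cnj (YY x t) + YY x t * cnj (XX x t) = 2 * of_real (Re M1)"
    unfolding cnj_E_E complex_norm_square by (simp_all add: complex_add_cnj)
  show ?thesis
    unfolding R_XYZ J_form_background J_form_expansion[OF null_00 null_0s null_1s] *
    by (simp add: aa_def bb_def dd_def mult_ac)
qed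

lemma bra_ket_J_lam0:
  "bra_ket (vector [of_real lam0 * c, u10 x t * p, u20 x t * r]) J_mat (vector [of_real lam0 * c', u10 x t * p', u20 x t * r'])
    = of_real mu0 * (cnj c * c') - of_real A * (cnj p * p') - of_real B * (cnj r * r')"
proof -
  have e: "cnj (of_real lam0 * c) * (of_real lam0 * c') = of_real (lam0\<^sup>2) * (cnj c * c')"
    "cnj (u10 x t * p) * (u10 x t * p') = (cnj (u10 x t) * u10 x t) * (cnj p * p')"
    "cnj (u20 x t * r) * (u20 x t * r') = (cnj (u20 x t) * u20 x t) * (cnj r * r')"
    by (simp_all add: power2_eq_square mult_ac)
  show ?thesis by (simp only: bra_ket_J vector_3 e[unfolded u10_sq u20_sq lam0_sq])
qed

lemma null_00_complex:
  "complex_of_real mu0 = of_real A * (of_real (hj k 0 chi0))\<^sup>2 + of_real B * (of_real (hj (- k) 0 chi0))\<^sup>2"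
  using arg_cong[OF null_00, of complex_of_real] by (simp add: algebra_simps)

lemma aJ_eq: "aJ x t = - of_real aa"
proof -
  define e h where "e = E chi0 x t" and "h = th (Suc 0) chi0 x t"
  have "aJ x t = (cnj e * e) * (h * (of_real mu0 - of_real A * (of_real (hj k 0 chi0))\<^sup>2
      - of_real B * (of_real (hj (- k) 0 chi0))\<^sup>2) - of_real aa)"
    unfolding aJ_def using Y_eq[of 0 x t] Y_eq[of 1 x t]
    by (simp add: T_0 T_1 mult.assoc bra_ket_J_lam0 Ej_simps aa_def e_def h_def)
      (simp add: algebra_simps power2_eq_square)
  then show ?thesis unfolding null_00_complex e_def cnj_E_E by simp
qed

lemma bJ_eq: "bJ x t = - of_real bb"
proof -
  define e h where "e = E chi0 x t" and "h = th (Suc 0) chi0 x t"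
  have h: "cnj h = - h" by (simp add: h_def cnj_th)
  have "bJ x t = (cnj e * e) * (- (h * h) * (of_real mu0 - of_real A * (of_real (hj k 0 chi0))\<^sup>2
      - of_real B * (of_real (hj (- k) 0 chi0))\<^sup>2) - of_real bb)"
    unfolding bJ_def using Y_eq[of 1 x t]
    by (simp add: T_1 mult.assoc bra_ket_J_lam0 Ej_simps bb_def h flip: e_def h_def)
      (simp add: algebra_simps power2_eq_square)
  then show ?thesis unfolding null_00_complex e_def cnj_E_E by simp
qed

lemma ds_eq: "ds x t = of_real dd"
proof -
  have "ds x t = (cnj (Es x t) * Es x t) * of_real dd"
    unfolding ds_def Ys_eq Ps_def Rs_def mult.assoc bra_ket_J_lam0 dd_def
    by (simp add: algebra_simps power2_eq_square)
  then show ?thesis unfolding cnj_E_E by simp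
qed

lemma XYZ_independent:
  assumes "XX x t + ZZ x t = 0"
    and "hj k 0 chi0 * XX x t + hj k 1 chi0 * YY x t + hj k 0 chis * ZZ x t = 0"
    and "hj (- k) 0 chi0 * XX x t + hj (- k) 1 chi0 * YY x t + hj (- k) 0 chis * ZZ x t = 0"
  shows False
proof -
  define X Y where "X = XX x t" and "Y = YY x t"
  have Z: "ZZ x t = - X" using assms(1) by (simp add: X_def add_eq_0_iff)
  \<comment> \<open>Each lower component, cleared of its poles, is a linear relation between X and Y
    that depends only on w; it is used at w = k and w = - k.\<close>
  have key: "of_real ((chis - chi0) * (w + chi0)) * X = of_real (w + chis) * Y"
    if "w \<noteq> 0" "w + chi0 \<noteq> 0" "w + chis \<noteq> 0"
      "hj w 0 chi0 * X + hj w 1 chi0 * Y - hj w 0 chis * X = 0" for w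
  proof -
    have r: "(w + chi0)\<^sup>2 * (w + chis) * (hj w 0 chi0 - hj w 0 chis) = w * ((chis - chi0) * (w + chi0))"
      "(w + chi0)\<^sup>2 * (w + chis) * hj w 1 chi0 = - w * (w + chis)"
    proof -
      define a b where "a = 1 / (w + chi0)" and "b = 1 / (w + chis)"
      have ab: "(w + chi0) * a = 1" "(w + chis) * b = 1" using that(2,3) by (simp_all add: a_def b_def)
      have h: "hj w 0 chi0 = w * a" "hj w 1 chi0 = - w * a\<^sup>2" "hj w 0 chis = w * b"
        by (simp_all add: hj_def a_def b_def power2_eq_square)
      show "(w + chi0)\<^sup>2 * (w + chis) * (hj w 0 chi0 - hj w 0 chis) = w * ((chis - chi0) * (w + chi0))"
        "(w + chi0)\<^sup>2 * (w + chis) * hj w 1 chi0 = - w * (w + chis)"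
        unfolding h using ab by algebra+
    qed
    have "0 = of_real ((w + chi0)\<^sup>2 * (w + chis)) * (hj w 0 chi0 * X + hj w 1 chi0 * Y - hj w 0 chis * X)"
      using that(4) by simp
    also have "\<dots> = of_real ((w + chi0)\<^sup>2 * (w + chis) * (hj w 0 chi0 - hj w 0 chis)) * X
        + of_real ((w + chi0)\<^sup>2 * (w + chis) * hj w 1 chi0) * Y"
      by (simp add: algebra_simps)
    also have "\<dots> = of_real w * (of_real ((chis - chi0) * (w + chi0)) * X - of_real (w + chis) * Y)"
      unfolding r by (simp add: algebra_simps)
    finally show ?thesis using that(1) by simp
  qed
  have 1: "of_real ((chis - chi0) * (k + chi0)) * X = of_real (k + chis) * Y"
    using assms(2) Z by (intro key k_nz chi0_nz chis_nz) (simp add: X_def Y_def)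
  have 2: "of_real ((chis - chi0) * (- k + chi0)) * X = of_real (- k + chis) * Y"
    using assms(3) Z k_nz by (intro key chi0_nz chis_nz) (simp_all add: X_def Y_def)
  \<comment> \<open>Subtracting the two relations eliminates the w-dependent part.\<close>
  have "of_real (2 * k) * Y = of_real (2 * k) * (of_real (chis - chi0) * X)"
    using 1 2 unfolding of_real_mult of_real_add of_real_diff of_real_minus by algebra
  then have Y: "Y = of_real (chis - chi0) * X" using k_nz by simp
  have "of_real ((chis - chi0)\<^sup>2) * X = 0"
    using 1 unfolding Y by (simp add: algebra_simps power2_eq_square)
  then have X: "X = 0" using L0_nz by (simp add: L0_def)
  \<comment> \<open>Y_0 enters y_R with coefficient 1: once M1 = 0, X is the exponential itself and
    cannot vanish.\<close>
  then have "M1 = 0" using Y by (simp add: Y_def YY_def E_def)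
  then have "XX x t = E chi0 x t" unfolding XX_def by simp
  then show False using X by (simp add: X_def E_def)
qed

end

section \<open>Isotropic yR and the properties of m_q\<close>

locale FL_rational = FL_admissible +
  fixes x0 t0 :: real
  assumes null_hyp: "bJ x0 t0 * of_real ((cmod M1)\<^sup>2) + 2 * aJ x0 t0 * of_real (Re M1)
      + ds x0 t0 * of_real ((cmod cs)\<^sup>2) = 0"
    and q_nonreal: "q \<notin> \<real>"
begin

text \<open>The constraint is given at one point only; \<open>aJ_eq\<close>, \<open>bJ_eq\<close>
  and \<open>ds_eq\<close> contain no (x, t), so it is the value of the form in
  \<open>J_form_R\<close> everywhere.\<close>

lemma null_R: "of_real mu0 * (cR x t * cnj (cR x t)) = pR x t * cnj (pR x t) + rR x t * cnj (rR x t)"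
  using J_form_R[of x t] null_hyp unfolding aJ_eq bJ_eq ds_eq by (simp add: algebra_simps)

text \<open>For an isotropic vector a vanishing first component forces the other two to vanish,
  contradicting linear independence.\<close>

lemma cR_nz: "cR x t \<noteq> 0"
proof
  assume c: "cR x t = 0"
  then have "complex_of_real ((cmod (pR x t))\<^sup>2 + (cmod (rR x t))\<^sup>2) = 0"
    using null_R[of x t] unfolding of_real_add complex_norm_square by simp
  then have "(cmod (pR x t))\<^sup>2 + (cmod (rR x t))\<^sup>2 = 0"
    by (simp only: of_real_eq_0_iff)
  then have "pR x t = 0" "rR x t = 0"
    by (simp_all add: sum_power2_eq_zero_iff)
  moreover have "u10 x t \<noteq> 0" "u20 x t \<noteq> 0"
    using u10_sq[of x t] u20_sq[of x t] A_pos B_pos by auto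
  ultimately show False
    using c XYZ_independent[of x t] unfolding R_XYZ by simp
qed

sublocale dp: FL_double_pole u10 v10 u20 v20 "of_real mu0" cR pR rR dR pM rM q
proof (intro FL_double_pole.intro FL_double_pole_axioms.intro)
  show "FL_seed u10 v10 u20 v20 (of_real mu0)" by (rule seed[OF mu0_pos])
qed (use lax_R lax_M null_R cR_nz q_nonreal in auto)

text \<open>By isotropy the two lower components together contribute as much as the first
  one.\<close>

lemma bra_ket_K_yR: "bra_ket (yR x t) K_mat (yR x t) = 2 * of_real mu0 * of_real ((cmod (cR x t))\<^sup>2)"
proof -
  have "bra_ket (yR x t) K_mat (yR x t) = of_real (lam0\<^sup>2) * (cR x t * cnj (cR x t))
      + (pR x t * cnj (pR x t) + rR x t * cnj (rR x t))"
    by (simp add: bra_ket_K yR_eq power2_eq_square mult_ac)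
  then show ?thesis unfolding lam0_sq null_R[symmetric] complex_norm_square by simp
qed

lemma bra_ket_ymu: "bra_ket (ymu x t) J_mat (yR x t) = dp.a x t"
  "bra_ket (yR x t) J_mat (ymu x t) = cnj (dp.a x t)"
proof -
  have l: "of_real mu0 = complex_of_real lam0 * of_real lam0"
    using arg_cong[OF lam0_sq, of complex_of_real] by (simp add: power2_eq_square)
  show "bra_ket (ymu x t) J_mat (yR x t) = dp.a x t"
    "bra_ket (yR x t) J_mat (ymu x t) = cnj (dp.a x t)"
    unfolding dp.a_def bra_ket_J yR_eq ymu_eq using lam0_pos by (simp_all add: l field_simps)
qed

lemma mq_eq: "mq x t = of_real lam0 * dp.M x t"
proof -
  have l: "of_real mu0 = complex_of_real lam0 * of_real lam0"
    using arg_cong[OF lam0_sq, of complex_of_real] by (simp add: power2_eq_square)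
  have K: "bra_ket (yR x t) K_mat (yR x t) / (2 * of_real lam0) = of_real lam0 * (cR x t * cnj (cR x t))"
    unfolding bra_ket_K_yR l complex_norm_square using lam0_pos by simp
  show ?thesis
    unfolding mq_def bra_ket_ymu K dp.M_def by (simp add: algebra_simps)
qed

lemma Re_mq: "Re (mq x t) = - lam0 * (cmod (cR x t))\<^sup>2"
  unfolding mq_eq by (simp add: dp.Re_M)

lemma u1R_eq: "u1R = dp.U1" and u2R_eq: "u2R = dp.U2"
  using lam0_pos
  by (auto simp: fun_eq_iff u1R_def u2R_def dp.U1_def dp.U2_def mq_eq yR_eq field_simps)

lemma smooth_inverse_M: "globally_smooth (\<lambda>x t. inverse (dp.M x t))"
proof (rule globally_smooth_inverse)
  show "globally_smooth dp.M"
    unfolding dp.M_def[abs_def] dp.a_def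
    by (intro globally_smooth_intros smooth_R smooth_M; simp add: dp.cnj_q[simplified])
qed (rule dp.M_nz)

lemma smooth_u1R: "globally_smooth u1R" and smooth_u2R: "globally_smooth u2R"
  unfolding u1R_eq u2R_eq dp.U1_def[abs_def] dp.U2_def[abs_def]
  by (intro globally_smooth_intros smooth_u10 smooth_u20 smooth_R smooth_inverse_M)+

lemma Re_mq_K:
  "complex_of_real (Re (mq x t)) = - bra_ket (yR x t) K_mat (yR x t) / (2 * of_real lam0)"
  "Re (mq x t) < 0"
proof -
  have l: "of_real mu0 = complex_of_real lam0 * of_real lam0"
    using arg_cong[OF lam0_sq, of complex_of_real] by (simp add: power2_eq_square)
  show "complex_of_real (Re (mq x t)) = - bra_ket (yR x t) K_mat (yR x t) / (2 * of_real lam0)"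
    unfolding Re_mq bra_ket_K_yR l using lam0_pos by simp
  show "Re (mq x t) < 0"
    unfolding Re_mq using lam0_pos cR_nz[of x t] by simp
qed

end

theorem theorem21:
  fixes A B a1 a2 k chi0 x0 t0 :: real and M1 cs q :: complex
  assumes "A > 0" and "B > 0" and "a1\<^sup>2 = A" and "a2\<^sup>2 = B"
    and "k \<noteq> 0"
    and "chi0 \<notin> {0, k, - k}"
    and "deriv (FL_double_root.Lam A B k) chi0 = 0"
    and "deriv (deriv (FL_double_root.Lam A B k)) chi0 \<noteq> 0"
    and "FL_double_root.bJ A B a1 a2 k chi0 x0 t0 * of_real ((cmod M1)\<^sup>2)
         + 2 * FL_double_root.aJ A B a1 a2 k chi0 x0 t0 * of_real (Re M1)
         + FL_double_root.ds A B a1 a2 k chi0 x0 t0 * of_real ((cmod cs)\<^sup>2) = 0"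
    and "q \<notin> \<real>"
  defines "yR \<equiv> FL_double_root.yR A B a1 a2 k chi0 M1 cs"
    and "mq \<equiv> FL_double_root.mq A B a1 a2 k chi0 M1 cs q"
    and "lam0 \<equiv> FL_double_root.lam0 A B k chi0"
    and "u1R \<equiv> FL_double_root.u1R A B a1 a2 k chi0 M1 cs q"
    and "u2R \<equiv> FL_double_root.u2R A B a1 a2 k chi0 M1 cs q"
  shows "(\<forall>x t. complex_of_real (Re (mq x t))
              = - bra_ket (yR x t) K_mat (yR x t) / (2 * of_real lam0)
            \<and> Re (mq x t) < 0)
       \<and> (\<forall>x t. mq x t \<noteq> 0)
       \<and> globally_smooth u1R \<and> globally_smooth u2R
       \<and> solves_coupled_FL u1R u2R"
proof -
  interpret FL: FL_rational A B a1 a2 k chi0 M1 cs q x0 t0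
    by unfold_locales (use assms in auto)
  have "mq x t \<noteq> 0" for x t
    using FL.Re_mq_K(2)[of x t] unfolding mq_def by fastforce
  moreover have "solves_coupled_FL u1R u2R"
    unfolding u1R_def u2R_def FL.u1R_eq FL.u2R_eq by (rule FL.dp.solves)
  ultimately show ?thesis
    unfolding yR_def mq_def lam0_def u1R_def u2R_def
    using FL.Re_mq_K FL.smooth_u1R FL.smooth_u2R by blast
qed

end
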